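(* Let $R$ be a right SAP ring which is right self-injective. Then $R$ is a von Neumann regular ring, and $R=R_1\oplus R_2$ as a direct sum of rings, where $R_1$ is a direct product of right full linear rings and the socle of $R_2$ is zero.
   Context: Rings are associative with identity and modules are unital right modules. A right $R$-module $M$ is absolutely pure if it is a pure submodule of every right $R$-module containing it. $R$ is a right SAP ring if every simple right $R$-module is absolutely pure. $R$ is right self-injective if $R_R$ is an injective right $R$-module. A right full linear ring is a ring isomorphic to the ring of all linear transformations of a right vector space over a division ring, with maps acting on the left. The socle of a ring is its right socle, i.e. the sum of all its minimal right ideals. Either summand may be the zero ring (the empty product of rings being the zero ring). *)

theory Defs
  imports "HOL-Algebra.Algebra"
begin

section \<open>Right modules\<close>

text \<open>
  The library locale \<open>module\<close> is restricted to commutative rings.  We reuse its record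
  for unital right modules over an arbitrary ring: the field \<open>r \<odot>\<^bsub>M\<^esub> x\<close> is
  the right action \<open>x r\<close>, whence the order of the factors in \<open>smult_assoc\<close>.
\<close>

locale right_module = R?: ring R + M?: abelian_group M
  for R :: "('a, 'c) ring_scheme" (structure) and M :: "('a, 'm) module" (structure) +
  assumes smult_closed [simp, intro]:
      "\<lbrakk>r \<in> carrier R; x \<in> carrier M\<rbrakk> \<Longrightarrow> r \<odot>\<^bsub>M\<^esub> x \<in> carrier M"
    and smult_l_distr:
      "\<lbrakk>r \<in> carrier R; s \<in> carrier R; x \<in> carrier M\<rbrakk>
        \<Longrightarrow> (r \<oplus> s) \<odot>\<^bsub>M\<^esub> x = r \<odot>\<^bsub>M\<^esub> x \<oplus>\<^bsub>M\<^esub> s \<odot>\<^bsub>M\<^esub> x"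
    and smult_r_distr:
      "\<lbrakk>r \<in> carrier R; x \<in> carrier M; y \<in> carrier M\<rbrakk>
        \<Longrightarrow> r \<odot>\<^bsub>M\<^esub> (x \<oplus>\<^bsub>M\<^esub> y) = r \<odot>\<^bsub>M\<^esub> x \<oplus>\<^bsub>M\<^esub> r \<odot>\<^bsub>M\<^esub> y"
    and smult_assoc:
      "\<lbrakk>r \<in> carrier R; s \<in> carrier R; x \<in> carrier M\<rbrakk>
        \<Longrightarrow> (r \<otimes> s) \<odot>\<^bsub>M\<^esub> x = s \<odot>\<^bsub>M\<^esub> (r \<odot>\<^bsub>M\<^esub> x)"
    and smult_one [simp]:
      "x \<in> carrier M \<Longrightarrow> \<one> \<odot>\<^bsub>M\<^esub> x = x"

definition rmod_hom ::
    "('a, 'c) ring_scheme \<Rightarrow> ('a, 'm) module \<Rightarrow> ('a, 'n) module \<Rightarrow> ('m \<Rightarrow> 'n) set" where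
  "rmod_hom R M N = {f. f \<in> carrier M \<rightarrow> carrier N \<and>
     (\<forall>x\<in>carrier M. \<forall>y\<in>carrier M. f (x \<oplus>\<^bsub>M\<^esub> y) = f x \<oplus>\<^bsub>N\<^esub> f y) \<and>
     (\<forall>r\<in>carrier R. \<forall>x\<in>carrier M. f (r \<odot>\<^bsub>M\<^esub> x) = r \<odot>\<^bsub>N\<^esub> f x)}"

definition rmod_mono ::
    "('a, 'c) ring_scheme \<Rightarrow> ('a, 'm) module \<Rightarrow> ('a, 'n) module \<Rightarrow> ('m \<Rightarrow> 'n) set" where
  "rmod_mono R M N = {f \<in> rmod_hom R M N. inj_on f (carrier M)}"

definition regular_rmod :: "('a, 'c) ring_scheme \<Rightarrow> ('a, 'a) module" where
  "regular_rmod R = \<lparr>carrier = carrier R, monoid.mult = monoid.mult R, one = one R,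
     ring.zero = ring.zero R, ring.add = ring.add R, smult = (\<lambda>r x. x \<otimes>\<^bsub>R\<^esub> r)\<rparr>"

definition simple_rmod :: "('a, 'c) ring_scheme \<Rightarrow> ('a, 'm) module \<Rightarrow> bool" where
  "simple_rmod R M \<longleftrightarrow> right_module R M \<and> carrier M \<noteq> {\<zero>\<^bsub>M\<^esub>} \<and>
     (\<forall>H. submodule H R M \<longrightarrow> H = {\<zero>\<^bsub>M\<^esub>} \<or> H = carrier M)"

text \<open>
  Purity in the sense of P. M. Cohn: every finite system of linear equations
  \<open>\<Sum>\<^bsub>j<n\<^esub> x\<^sub>j a\<^sub>i\<^sub>j = b\<^sub>i\<close> \<open>(i < m)\<close> with coefficients in \<open>R\<close> and right-hand sides in
  \<open>N\<close> that is solvable in \<open>M\<close> is solvable in \<open>N\<close>.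
\<close>

definition pure_submodule :: "('a, 'c) ring_scheme \<Rightarrow> ('a, 'm) module \<Rightarrow> 'm set \<Rightarrow> bool" where
  "pure_submodule R M N \<longleftrightarrow> submodule N R M \<and>
     (\<forall>(m::nat) (n::nat) a b.
        (\<forall>i<m. \<forall>j<n. a i j \<in> carrier R) \<and> (\<forall>i<m. b i \<in> N) \<and>
        (\<exists>x. (\<forall>j<n. x j \<in> carrier M) \<and> (\<forall>i<m. (\<Oplus>\<^bsub>M\<^esub>j\<in>{..<n}. a i j \<odot>\<^bsub>M\<^esub> x j) = b i))
        \<longrightarrow> (\<exists>y. (\<forall>j<n. y j \<in> N) \<and> (\<forall>i<m. (\<Oplus>\<^bsub>M\<^esub>j\<in>{..<n}. a i j \<odot>\<^bsub>M\<^esub> y j) = b i)))"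

text \<open>
  HOL cannot quantify over modules with carriers in all types, so the quantifiers over
  modules below range over carriers in one sufficiently large type.  That this is no
  restriction is proved at the end of this theory: \<open>absolutely_pure_any_type\<close>,
  \<open>right_SAP_any_type\<close> and \<open>injective_rmod_any_type\<close> recover the respective property
  for modules over arbitrary types.  ``Containing'' is rendered by embeddings.
\<close>

definition absolutely_pure :: "('a, 'c) ring_scheme \<Rightarrow> ('a, 'n) module \<Rightarrow> bool" where
  "absolutely_pure R N \<longleftrightarrow> right_module R N \<and>
     (\<forall>(M :: ('a, 'n \<times> 'a list) module) f. right_module R M \<and> f \<in> rmod_mono R N M
        \<longrightarrow> pure_submodule R M (f ` carrier N))"

definition right_SAP :: "('a, 'c) ring_scheme \<Rightarrow> bool" where
  "right_SAP R \<longleftrightarrow> ring R \<and>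
     (\<forall>S :: ('a, 'a) module. simple_rmod R S \<longrightarrow> absolutely_pure R S)"

definition injective_rmod :: "('a, 'c) ring_scheme \<Rightarrow> ('a, 'e) module \<Rightarrow> bool" where
  "injective_rmod R E \<longleftrightarrow> right_module R E \<and>
     (\<forall>(A :: ('a, 'e \<times> 'a list) module) (B :: ('a, 'e \<times> 'a list) module) f g.
        right_module R A \<and> right_module R B \<and> f \<in> rmod_mono R A B \<and> g \<in> rmod_hom R A E
        \<longrightarrow> (\<exists>h\<in>rmod_hom R B E. \<forall>x\<in>carrier A. h (f x) = g x))"

definition right_self_injective :: "('a, 'c) ring_scheme \<Rightarrow> bool" where
  "right_self_injective R \<longleftrightarrow> injective_rmod R (regular_rmod R)"


section \<open>Rings\<close>

definition von_neumann_regular :: "('a, 'c) ring_scheme \<Rightarrow> bool" where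
  "von_neumann_regular R \<longleftrightarrow> ring R \<and>
     (\<forall>a\<in>carrier R. \<exists>x\<in>carrier R. a \<otimes>\<^bsub>R\<^esub> x \<otimes>\<^bsub>R\<^esub> a = a)"

definition division_ring :: "('a, 'c) ring_scheme \<Rightarrow> bool" where
  "division_ring D \<longleftrightarrow> ring D \<and> \<one>\<^bsub>D\<^esub> \<noteq> \<zero>\<^bsub>D\<^esub> \<and> Units D = carrier D - {\<zero>\<^bsub>D\<^esub>}"

text \<open>Endomorphisms are extensional functions, so that equality in the ring is equality
  on the carrier; they act on the left, i.e. the product is \<open>(f g) x = f (g x)\<close>.\<close>

definition rmod_End :: "('a, 'c) ring_scheme \<Rightarrow> ('a, 'm) module \<Rightarrow> ('m \<Rightarrow> 'm) ring" where
  "rmod_End R M = \<lparr>carrier = rmod_hom R M M \<inter> extensional (carrier M),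
     monoid.mult = compose (carrier M), one = (\<lambda>x\<in>carrier M. x),
     ring.zero = (\<lambda>x\<in>carrier M. \<zero>\<^bsub>M\<^esub>), ring.add = (\<lambda>f g. \<lambda>x\<in>carrier M. f x \<oplus>\<^bsub>M\<^esub> g x)\<rparr>"

text \<open>
  The type \<open>'s list\<close> is large enough for the witnesses: if \<open>V \<noteq> 0\<close>, both \<open>D\<close> and \<open>V\<close>
  embed as sets into \<open>End(V\<^sub>D)\<close>, and hence into \<open>S\<close>; if \<open>V = 0\<close>, take any division ring,
  e.g. one with two elements.
\<close>

definition right_full_linear_ring :: "('s, 'c) ring_scheme \<Rightarrow> bool" where
  "right_full_linear_ring S \<longleftrightarrow> ring S \<and>
     (\<exists>(D :: 's list ring) (V :: ('s list, 's list) module).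
        division_ring D \<and> right_module D V \<and> S \<simeq> rmod_End D V)"

definition ring_product :: "'i set \<Rightarrow> ('i \<Rightarrow> ('a, 'c) ring_scheme) \<Rightarrow> ('i \<Rightarrow> 'a) ring" where
  "ring_product I S = \<lparr>carrier = (\<Pi>\<^sub>E i\<in>I. carrier (S i)),
     monoid.mult = (\<lambda>x y. \<lambda>i\<in>I. x i \<otimes>\<^bsub>S i\<^esub> y i), one = (\<lambda>i\<in>I. \<one>\<^bsub>S i\<^esub>),
     ring.zero = (\<lambda>i\<in>I. \<zero>\<^bsub>S i\<^esub>), ring.add = (\<lambda>x y. \<lambda>i\<in>I. x i \<oplus>\<^bsub>S i\<^esub> y i)\<rparr>"

definition minimal_right_ideal :: "('a, 'c) ring_scheme \<Rightarrow> 'a set \<Rightarrow> bool" where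
  "minimal_right_ideal R J \<longleftrightarrow> submodule J R (regular_rmod R) \<and> J \<noteq> {\<zero>\<^bsub>R\<^esub>} \<and>
     (\<forall>H. submodule H R (regular_rmod R) \<and> H \<subseteq> J \<longrightarrow> H = {\<zero>\<^bsub>R\<^esub>} \<or> H = J)"

text \<open>The sum of a family of right ideals is the additive subgroup generated by its union.\<close>

definition right_socle :: "('a, 'c) ring_scheme \<Rightarrow> 'a set" where
  "right_socle R = generate (add_monoid R) (\<Union>{J. minimal_right_ideal R J})"


section \<open>Independence of the carrier types\<close>

lemma rmod_homI:
  assumes "\<And>x. x \<in> carrier M \<Longrightarrow> f x \<in> carrier N"
    and "\<And>x y. \<lbrakk>x \<in> carrier M; y \<in> carrier M\<rbrakk> \<Longrightarrow> f (x \<oplus>\<^bsub>M\<^esub> y) = f x \<oplus>\<^bsub>N\<^esub> f y"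
    and "\<And>r x. \<lbrakk>r \<in> carrier R; x \<in> carrier M\<rbrakk> \<Longrightarrow> f (r \<odot>\<^bsub>M\<^esub> x) = r \<odot>\<^bsub>N\<^esub> f x"
  shows "f \<in> rmod_hom R M N"
  using assms by (auto simp: rmod_hom_def)

lemma rmod_homD:
  assumes "f \<in> rmod_hom R M N"
  shows "x \<in> carrier M \<Longrightarrow> f x \<in> carrier N"
    and "\<lbrakk>x \<in> carrier M; y \<in> carrier M\<rbrakk> \<Longrightarrow> f (x \<oplus>\<^bsub>M\<^esub> y) = f x \<oplus>\<^bsub>N\<^esub> f y"
    and "\<lbrakk>r \<in> carrier R; x \<in> carrier M\<rbrakk> \<Longrightarrow> f (r \<odot>\<^bsub>M\<^esub> x) = r \<odot>\<^bsub>N\<^esub> f x"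
  using assms by (auto simp: rmod_hom_def)

lemma rmod_hom_comp:
  assumes "f \<in> rmod_hom R M N" "g \<in> rmod_hom R N P"
  shows "g \<circ> f \<in> rmod_hom R M P"
  using assms by (auto simp: rmod_hom_def Pi_iff)

lemma rmod_mono_comp:
  assumes "f \<in> rmod_mono R M N" "g \<in> rmod_mono R N P"
  shows "g \<circ> f \<in> rmod_mono R M P"
proof -
  have "g \<circ> f \<in> rmod_hom R M P"
    using assms by (auto simp: rmod_mono_def intro: rmod_hom_comp)
  moreover have "f ` carrier M \<subseteq> carrier N"
    using assms(1) by (auto simp: rmod_mono_def dest: rmod_homD(1))
  ultimately show ?thesis
    using assms by (auto simp: rmod_mono_def intro!: comp_inj_on intro: inj_on_subset)
qed

lemma rmod_hom_zero:
  assumes "right_module R M" "right_module R N" "f \<in> rmod_hom R M N"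
  shows "f \<zero>\<^bsub>M\<^esub> = \<zero>\<^bsub>N\<^esub>"
proof -
  interpret M: right_module R M by fact
  interpret N: right_module R N by fact
  have "f \<zero>\<^bsub>M\<^esub> \<oplus>\<^bsub>N\<^esub> f \<zero>\<^bsub>M\<^esub> = f \<zero>\<^bsub>M\<^esub>"
    using rmod_homD(2)[OF assms(3), of "\<zero>\<^bsub>M\<^esub>" "\<zero>\<^bsub>M\<^esub>"] by simp
  then show ?thesis
    using rmod_homD(1)[OF assms(3), of "\<zero>\<^bsub>M\<^esub>"] by (metis N.M.add.r_cancel_one M.M.zero_closed)
qed

lemma rmod_hom_finsum:
  assumes "right_module R M" "right_module R N" "f \<in> rmod_hom R M N"
    and "finite A" "x \<in> A \<rightarrow> carrier M"
  shows "f (\<Oplus>\<^bsub>M\<^esub>i\<in>A. x i) = (\<Oplus>\<^bsub>N\<^esub>i\<in>A. f (x i))"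
proof -
  interpret M: right_module R M by fact
  interpret N: right_module R N by fact
  show ?thesis
    using assms(4,5)
  proof (induction A rule: finite_induct)
    case empty
    then show ?case by (simp add: rmod_hom_zero[OF assms(1-3)])
  next
    case (insert i A)
    then have "x i \<in> carrier M" "x \<in> A \<rightarrow> carrier M" by auto
    moreover from this have "(\<lambda>i. f (x i)) \<in> A \<rightarrow> carrier N" "f (x i) \<in> carrier N"
      using rmod_homD(1)[OF assms(3)] by auto
    ultimately show ?case
      using insert by (simp add: rmod_homD(2)[OF assms(3)] M.M.finsum_closed)
  qed
qed

lemma (in right_module) smult_l_null: 
  assumes "x \<in> carrier M" shows "\<zero> \<odot>\<^bsub>M\<^esub> x = \<zero>\<^bsub>M\<^esub>"
proof -
  have "\<zero> \<odot>\<^bsub>M\<^esub> x \<oplus>\<^bsub>M\<^esub> \<zero> \<odot>\<^bsub>M\<^esub> x = \<zero> \<odot>\<^bsub>M\<^esub> x"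
    using smult_l_distr[of \<zero> \<zero> x] assms by simp
  then show ?thesis using assms by (metis M.add.r_cancel_one R.zero_closed smult_closed)
qed

lemma (in right_module) smult_r_null: 
  assumes "r \<in> carrier R" shows "r \<odot>\<^bsub>M\<^esub> \<zero>\<^bsub>M\<^esub> = \<zero>\<^bsub>M\<^esub>"
proof -
  have "r \<odot>\<^bsub>M\<^esub> \<zero>\<^bsub>M\<^esub> \<oplus>\<^bsub>M\<^esub> r \<odot>\<^bsub>M\<^esub> \<zero>\<^bsub>M\<^esub> = r \<odot>\<^bsub>M\<^esub> \<zero>\<^bsub>M\<^esub>"
    using smult_r_distr[of r "\<zero>\<^bsub>M\<^esub>" "\<zero>\<^bsub>M\<^esub>"] assms by simp
  then show ?thesis using assms by (metis M.add.r_cancel_one M.zero_closed smult_closed)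
qed

lemma (in right_module) smult_minus_one:
  assumes "x \<in> carrier M" shows "(\<ominus> \<one>) \<odot>\<^bsub>M\<^esub> x = \<ominus>\<^bsub>M\<^esub> x"
proof -
  have "(\<ominus> \<one>) \<odot>\<^bsub>M\<^esub> x \<oplus>\<^bsub>M\<^esub> x = \<zero>\<^bsub>M\<^esub>"
    using smult_l_distr[of "\<ominus> \<one>" \<one> x] assms by (simp add: R.l_neg smult_l_null)
  then show ?thesis using assms by (simp add: M.minus_equality)
qed

lemma (in right_module) submoduleI':
  assumes "H \<subseteq> carrier M" "\<zero>\<^bsub>M\<^esub> \<in> H"
    and "\<And>x y. \<lbrakk>x \<in> H; y \<in> H\<rbrakk> \<Longrightarrow> x \<oplus>\<^bsub>M\<^esub> y \<in> H"
    and smul: "\<And>r x. \<lbrakk>r \<in> carrier R; x \<in> H\<rbrakk> \<Longrightarrow> r \<odot>\<^bsub>M\<^esub> x \<in> H"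
  shows "submodule H R M"
proof -
  have "\<ominus>\<^bsub>M\<^esub> x \<in> H" if "x \<in> H" for x
    using smul[of "\<ominus> \<one>" x] that assms(1) smult_minus_one[of x] by auto
  then have "subgroup H (add_monoid M)"
    using assms(1-3) by (intro subgroup.intro) (auto simp: a_inv_def)
  then show ?thesis
    using smul by (simp add: submodule_def submodule_axioms_def)
qed

lemma submoduleD:
  assumes "submodule H R M"
  shows "H \<subseteq> carrier M" "\<zero>\<^bsub>M\<^esub> \<in> H"
    and "\<And>x y. \<lbrakk>x \<in> H; y \<in> H\<rbrakk> \<Longrightarrow> x \<oplus>\<^bsub>M\<^esub> y \<in> H"
    and "\<And>r x. \<lbrakk>r \<in> carrier R; x \<in> H\<rbrakk> \<Longrightarrow> r \<odot>\<^bsub>M\<^esub> x \<in> H"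
proof -
  interpret submodule H R M by fact
  show "H \<subseteq> carrier M" "\<zero>\<^bsub>M\<^esub> \<in> H"
     "\<And>x y. \<lbrakk>x \<in> H; y \<in> H\<rbrakk> \<Longrightarrow> x \<oplus>\<^bsub>M\<^esub> y \<in> H"
     "\<And>r x. \<lbrakk>r \<in> carrier R; x \<in> H\<rbrakk> \<Longrightarrow> r \<odot>\<^bsub>M\<^esub> x \<in> H"
    using subset one_closed m_closed smult_closed by auto
qed

lemma (in right_module) right_module_by_embedding:
  fixes N :: "('a, 'n) module"
  assumes "\<And>x y. \<lbrakk>x \<in> carrier N; y \<in> carrier N\<rbrakk> \<Longrightarrow> x \<oplus>\<^bsub>N\<^esub> y \<in> carrier N"
    and "\<zero>\<^bsub>N\<^esub> \<in> carrier N"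
    and "\<And>r x. \<lbrakk>r \<in> carrier R; x \<in> carrier N\<rbrakk> \<Longrightarrow> r \<odot>\<^bsub>N\<^esub> x \<in> carrier N"
    and h: "h \<in> carrier N \<rightarrow> carrier M" "inj_on h (carrier N)" "h \<zero>\<^bsub>N\<^esub> = \<zero>\<^bsub>M\<^esub>"
     "\<And>x y. \<lbrakk>x \<in> carrier N; y \<in> carrier N\<rbrakk> \<Longrightarrow> h (x \<oplus>\<^bsub>N\<^esub> y) = h x \<oplus>\<^bsub>M\<^esub> h y"
     "\<And>r x. \<lbrakk>r \<in> carrier R; x \<in> carrier N\<rbrakk> \<Longrightarrow> h (r \<odot>\<^bsub>N\<^esub> x) = r \<odot>\<^bsub>M\<^esub> h x"
  shows "right_module R N" "h \<in> rmod_mono R N M"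
proof -
  have hc: "h x \<in> carrier M" if "x \<in> carrier N" for x using h(1) that by auto
  have eq: "x = y" if "x \<in> carrier N" "y \<in> carrier N" "h x = h y" for x y
    using h(2) that by (auto simp: inj_on_def)
  have ab: "abelian_group N"
  proof (rule abelian_groupI)
    fix x assume x: "x \<in> carrier N"
    have "(\<ominus> \<one>) \<odot>\<^bsub>N\<^esub> x \<oplus>\<^bsub>N\<^esub> x = \<zero>\<^bsub>N\<^esub>"
      using x assms(1-3) by (intro eq) (auto simp: h hc smult_minus_one M.l_neg)
    then show "\<exists>y\<in>carrier N. y \<oplus>\<^bsub>N\<^esub> x = \<zero>\<^bsub>N\<^esub>" using x assms(3) by blast
  qed (use assms(1-3) in \<open>auto intro!: eq simp: h hc M.a_ac\<close>)
  show "right_module R N"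
    using ab assms(1-3)
    by (intro right_module.intro right_module_axioms.intro R.ring_axioms)
       (auto intro!: eq simp: h hc smult_l_distr smult_r_distr smult_assoc)
  show "h \<in> rmod_mono R N M"
    using h hc by (auto simp: rmod_mono_def rmod_hom_def)
qed

definition restrict_rmod :: "('a, 'm) module \<Rightarrow> 'm set \<Rightarrow> ('a, 'm) module" where
  "restrict_rmod M H = M\<lparr>carrier := H\<rparr>"

lemma restrict_rmod:
  assumes "right_module R M" "submodule H R M"
  shows "right_module R (restrict_rmod M H)" "(\<lambda>x. x) \<in> rmod_mono R (restrict_rmod M H) M"
proof -
  interpret right_module R M by fact
  note H = submoduleD[OF assms(2)]
  show "right_module R (restrict_rmod M H)" "(\<lambda>x. x) \<in> rmod_mono R (restrict_rmod M H) M"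
    by (rule right_module_by_embedding[of "restrict_rmod M H" "\<lambda>x. x"];
        use H in \<open>auto simp: restrict_rmod_def inj_on_def\<close>)+
qed

definition transport_rmod :: "('m \<Rightarrow> 'n) \<Rightarrow> ('a, 'm) module \<Rightarrow> ('a, 'n) module" where
  "transport_rmod g M = \<lparr>carrier = g ` carrier M, monoid.mult = undefined, one = undefined,
     ring.zero = g \<zero>\<^bsub>M\<^esub>,
     ring.add = (\<lambda>x y. g (inv_into (carrier M) g x \<oplus>\<^bsub>M\<^esub> inv_into (carrier M) g y)),
     smult = (\<lambda>r x. g (r \<odot>\<^bsub>M\<^esub> inv_into (carrier M) g x))\<rparr>"

lemma transport_rmod:
  assumes "right_module R M" "inj_on g (carrier M)"
  shows "right_module R (transport_rmod g M)"
    and "g \<in> rmod_mono R M (transport_rmod g M)"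
    and "inv_into (carrier M) g \<in> rmod_mono R (transport_rmod g M) M"
proof -
  interpret right_module R M by fact
  note [simp] = inv_into_f_f[OF assms(2)]
  show "right_module R (transport_rmod g M)"
       "inv_into (carrier M) g \<in> rmod_mono R (transport_rmod g M) M"
    by (rule right_module_by_embedding[of "transport_rmod g M" "inv_into (carrier M) g"];
        use assms(2) in \<open>force simp: transport_rmod_def inj_on_def\<close>)+
  show "g \<in> rmod_mono R M (transport_rmod g M)"
    using assms(2) by (auto simp: transport_rmod_def rmod_mono_def rmod_hom_def)
qed

lemma submodule_image:
  assumes "right_module R M" "right_module R N" "f \<in> rmod_hom R M N" "submodule H R M"
  shows "submodule (f ` H) R N"
proof -
  interpret M: right_module R M by fact
  interpret N: right_module R N by fact
  note H = submoduleD[OF assms(4)] and f = rmod_homD[OF assms(3)]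
  show ?thesis
  proof (rule N.submoduleI')
    show "f ` H \<subseteq> carrier N" using f(1) H(1) by auto
    show "\<zero>\<^bsub>N\<^esub> \<in> f ` H" using rmod_hom_zero[OF assms(1-3)] H(2) by (metis imageI)
  next
    fix x y assume "x \<in> f ` H" "y \<in> f ` H"
    then obtain u v where uv: "u \<in> H" "v \<in> H" "x = f u" "y = f v" by auto
    then have "x \<oplus>\<^bsub>N\<^esub> y = f (u \<oplus>\<^bsub>M\<^esub> v)" using f(2)[of u v] H(1) by (simp add: subset_iff)
    then show "x \<oplus>\<^bsub>N\<^esub> y \<in> f ` H" using H(3) uv by auto
  next
    fix r x assume r: "r \<in> carrier R" and "x \<in> f ` H"
    then obtain u where u: "u \<in> H" "x = f u" by auto
    then have "r \<odot>\<^bsub>N\<^esub> x = f (r \<odot>\<^bsub>M\<^esub> u)" using f(3)[of r u] H(1) r by auto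
    then show "r \<odot>\<^bsub>N\<^esub> x \<in> f ` H" using H(4) u r by auto
  qed
qed

lemma carrier_submodule:
  assumes "right_module R M" shows "submodule (carrier M) R M"
proof -
  interpret right_module R M by fact
  show ?thesis by (rule submoduleI') auto
qed

lemma rmod_hom_linear_combination:
  fixes m n :: nat
  assumes "right_module R K" "right_module R M" "k \<in> rmod_hom R K M"
    and "\<forall>i<m. \<forall>j<n. a i j \<in> carrier R" "\<forall>j<n. y j \<in> carrier K"
    and "i < m"
  shows "(\<Oplus>\<^bsub>M\<^esub>j\<in>{..<n}. a i j \<odot>\<^bsub>M\<^esub> k (y j)) = k (\<Oplus>\<^bsub>K\<^esub>j\<in>{..<n}. a i j \<odot>\<^bsub>K\<^esub> y j)"
proof -
  interpret K: right_module R K by fact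
  interpret M: right_module R M by fact
  note k = rmod_homD[OF assms(3)]
  have "k (\<Oplus>\<^bsub>K\<^esub>j\<in>{..<n}. a i j \<odot>\<^bsub>K\<^esub> y j) = (\<Oplus>\<^bsub>M\<^esub>j\<in>{..<n}. k (a i j \<odot>\<^bsub>K\<^esub> y j))"
    using assms by (intro rmod_hom_finsum[OF assms(1-3)]) auto
  also have "\<dots> = (\<Oplus>\<^bsub>M\<^esub>j\<in>{..<n}. a i j \<odot>\<^bsub>M\<^esub> k (y j))"
    using assms(4-6) k by (intro M.M.finsum_cong') auto
  finally show ?thesis by simp
qed

lemma pure_submoduleD:
  fixes m n :: nat
  assumes "pure_submodule R M N" "\<forall>i<m. \<forall>j<n. a i j \<in> carrier R" "\<forall>i<m. b i \<in> N"
    and "\<forall>j<n. x j \<in> carrier M" "\<forall>i<m. (\<Oplus>\<^bsub>M\<^esub>j\<in>{..<n}. a i j \<odot>\<^bsub>M\<^esub> x j) = b i"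
  shows "\<exists>y. (\<forall>j<n. y j \<in> N) \<and> (\<forall>i<m. (\<Oplus>\<^bsub>M\<^esub>j\<in>{..<n}. a i j \<odot>\<^bsub>M\<^esub> y j) = b i)"
  by (rule assms(1)[unfolded pure_submodule_def, THEN conjunct2, THEN spec, THEN spec,
        THEN spec, THEN spec, THEN mp])
     (intro conjI exI[of _ x] assms)

theorem absolutely_pure_any_type:
  fixes N :: "('a, 'n) module" and M :: "('a, 'm) module"
  assumes ap: "absolutely_pure R N" and M: "right_module R M" and f: "f \<in> rmod_mono R N M"
  shows "pure_submodule R M (f ` carrier N)"
  unfolding pure_submodule_def
proof (intro conjI allI impI; (elim conjE exE)?)
  have N: "right_module R N" using ap by (simp add: absolutely_pure_def)
  have fh: "f \<in> rmod_hom R N M" and finj: "inj_on f (carrier N)"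
    using f by (auto simp: rmod_mono_def)
  interpret N: right_module R N by fact
  interpret M: right_module R M by fact
  note fD = rmod_homD[OF fh]
  show "submodule (f ` carrier N) R M"
    using submodule_image[OF N M fh carrier_submodule[OF N]] .
  fix m n :: nat and a b x
  assume a: "\<forall>i<m. \<forall>j<n. a i j \<in> carrier R" and b: "\<forall>i<m. b i \<in> f ` carrier N"
    and x: "\<forall>j<n. x j \<in> carrier M" 
    and sol: "\<forall>i<m. (\<Oplus>\<^bsub>M\<^esub>j\<in>{..<n}. a i j \<odot>\<^bsub>M\<^esub> x j) = b i"
  define lin where "lin = (\<lambda>(y, rs). f y \<oplus>\<^bsub>M\<^esub> (\<Oplus>\<^bsub>M\<^esub>j\<in>{..<n}. (rs ! j) \<odot>\<^bsub>M\<^esub> x j))"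
  define P where "P = carrier N \<times> {rs. length rs = n \<and> (\<forall>j<n. rs ! j \<in> carrier R)}"
  define K where "K = lin ` P"
  have sc: "(\<lambda>j. (rs ! j) \<odot>\<^bsub>M\<^esub> x j) \<in> {..<n} \<rightarrow> carrier M" if "\<forall>j<n. rs ! j \<in> carrier R" for rs
    using that x by auto
  have KM: "K \<subseteq> carrier M"
    using fD(1) sc by (auto simp: K_def P_def lin_def)
  have fK: "f y \<in> K" if "y \<in> carrier N" for y
  proof -
    have "(\<Oplus>\<^bsub>M\<^esub>j\<in>{..<n}. (replicate n \<zero>\<^bsub>R\<^esub> ! j) \<odot>\<^bsub>M\<^esub> x j) = (\<Oplus>\<^bsub>M\<^esub>j\<in>{..<n}. \<zero>\<^bsub>M\<^esub>)"
      using x by (intro M.M.finsum_cong') (auto simp: M.smult_l_null)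
    then have "lin (y, replicate n \<zero>\<^bsub>R\<^esub>) = f y"
      using that fD(1) by (simp add: lin_def M.M.finsum_zero)
    moreover have "(y, replicate n \<zero>\<^bsub>R\<^esub>) \<in> P" using that by (simp add: P_def)
    ultimately show ?thesis unfolding K_def by (metis imageI)
  qed
  have xK: "x l \<in> K" if "l < n" for l
  proof -
    define e where "e = map (\<lambda>j. if j = l then \<one>\<^bsub>R\<^esub> else \<zero>\<^bsub>R\<^esub>) [0..<n]"
    have "(\<Oplus>\<^bsub>M\<^esub>j\<in>{..<n}. (e ! j) \<odot>\<^bsub>M\<^esub> x j) = (\<Oplus>\<^bsub>M\<^esub>j\<in>{..<n}. if l = j then x j else \<zero>\<^bsub>M\<^esub>)"
      using x by (intro M.M.finsum_cong') (auto simp: M.smult_l_null e_def)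
    also have "\<dots> = x l" using x that by (intro M.M.finsum_singleton) auto
    finally have "lin (\<zero>\<^bsub>N\<^esub>, e) = x l"
      using that x by (simp add: lin_def rmod_hom_zero[OF N M fh])
    moreover have "(\<zero>\<^bsub>N\<^esub>, e) \<in> P" by (simp add: P_def e_def)
    ultimately show ?thesis unfolding K_def by (metis imageI)
  qed
  have Ksub: "submodule K R M"
  proof (rule M.submoduleI'[OF KM])
    show "\<zero>\<^bsub>M\<^esub> \<in> K" using fK[of "\<zero>\<^bsub>N\<^esub>"] by (simp add: rmod_hom_zero[OF N M fh])
  next
    fix u v assume "u \<in> K" "v \<in> K"
    then obtain y rs z ss where y: "(y, rs) \<in> P" "u = lin (y, rs)"
      and z: "(z, ss) \<in> P" "v = lin (z, ss)" unfolding K_def by (metis imageE surj_pair)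
    define ts where "ts = map (\<lambda>j. rs ! j \<oplus>\<^bsub>R\<^esub> ss ! j) [0..<n]"
    have P: "(y \<oplus>\<^bsub>N\<^esub> z, ts) \<in> P" using y z by (auto simp: P_def ts_def)
    have "(\<Oplus>\<^bsub>M\<^esub>j\<in>{..<n}. (ts ! j) \<odot>\<^bsub>M\<^esub> x j)
        = (\<Oplus>\<^bsub>M\<^esub>j\<in>{..<n}. (rs ! j) \<odot>\<^bsub>M\<^esub> x j \<oplus>\<^bsub>M\<^esub> (ss ! j) \<odot>\<^bsub>M\<^esub> x j)"
      using x y z by (intro M.M.finsum_cong') (auto simp: ts_def P_def M.smult_l_distr)
    also have "\<dots> = (\<Oplus>\<^bsub>M\<^esub>j\<in>{..<n}. (rs ! j) \<odot>\<^bsub>M\<^esub> x j) \<oplus>\<^bsub>M\<^esub> (\<Oplus>\<^bsub>M\<^esub>j\<in>{..<n}. (ss ! j) \<odot>\<^bsub>M\<^esub> x j)"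
      using y z sc by (intro M.M.finsum_addf) (auto simp: P_def)
    finally have "lin (y \<oplus>\<^bsub>N\<^esub> z, ts) = u \<oplus>\<^bsub>M\<^esub> v"
      using y z sc fD(1)
      by (auto simp: lin_def P_def fD(2) M.M.a_ac)
    then show "u \<oplus>\<^bsub>M\<^esub> v \<in> K" using P unfolding K_def by (metis imageI)
  next
    fix r u assume r: "r \<in> carrier R" and "u \<in> K"
    then obtain y rs where y: "(y, rs) \<in> P" "u = lin (y, rs)"
      unfolding K_def by (metis imageE surj_pair)
    define ts where "ts = map (\<lambda>j. rs ! j \<otimes>\<^bsub>R\<^esub> r) [0..<n]"
    have P: "(r \<odot>\<^bsub>N\<^esub> y, ts) \<in> P" using y r by (auto simp: P_def ts_def)
    have fin: "r \<odot>\<^bsub>M\<^esub> (\<Oplus>\<^bsub>M\<^esub>j\<in>A. z j) = (\<Oplus>\<^bsub>M\<^esub>j\<in>A. r \<odot>\<^bsub>M\<^esub> z j)" 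
      if "finite A" "z \<in> A \<rightarrow> carrier M" for z and A :: "nat set"
      using that
    proof (induction A rule: finite_induct)
      case empty then show ?case using r by (simp add: M.smult_r_null)
    next
      case (insert j A)
      then have z: "z j \<in> carrier M" "z \<in> A \<rightarrow> carrier M" by auto
      then have "(\<lambda>j. r \<odot>\<^bsub>M\<^esub> z j) \<in> A \<rightarrow> carrier M" using r by auto
      then show ?case using insert z r by (simp add: M.smult_r_distr)
    qed
    have "(\<Oplus>\<^bsub>M\<^esub>j\<in>{..<n}. (ts ! j) \<odot>\<^bsub>M\<^esub> x j) = (\<Oplus>\<^bsub>M\<^esub>j\<in>{..<n}. r \<odot>\<^bsub>M\<^esub> ((rs ! j) \<odot>\<^bsub>M\<^esub> x j))"
      using x y r by (intro M.M.finsum_cong') (auto simp: ts_def P_def M.smult_assoc)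
    also have "\<dots> = r \<odot>\<^bsub>M\<^esub> (\<Oplus>\<^bsub>M\<^esub>j\<in>{..<n}. (rs ! j) \<odot>\<^bsub>M\<^esub> x j)"
      using y sc by (intro fin[symmetric]) (auto simp: P_def)
    finally have "lin (r \<odot>\<^bsub>N\<^esub> y, ts) = r \<odot>\<^bsub>M\<^esub> u"
      using y r sc fD(1) by (auto simp: lin_def P_def fD(3) M.smult_r_distr)
    then show "r \<odot>\<^bsub>M\<^esub> u \<in> K" using P unfolding K_def by (metis imageI)
  qed
  define K0 where "K0 = restrict_rmod M K"
  have cK0 [simp]: "carrier K0 = K" by (simp add: K0_def restrict_rmod_def)
  have K0: "right_module R K0" and inc: "(\<lambda>x. x) \<in> rmod_hom R K0 M"
    using restrict_rmod[OF M Ksub] by (auto simp: K0_def rmod_mono_def)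
  define g where "g = inv_into P lin"
  have ginj: "inj_on g (carrier K0)" unfolding g_def cK0 K_def by (rule inj_on_inv_into) simp
  define T where "T = transport_rmod g K0"
  have T: "right_module R T" and gT: "g \<in> rmod_mono R K0 T"
    and hT: "inv_into (carrier K0) g \<in> rmod_mono R T K0"
    using transport_rmod[OF K0 ginj] by (auto simp: T_def)
  have fN: "f \<in> rmod_mono R N K0"
    using f fK by (auto simp: rmod_mono_def rmod_hom_def K0_def restrict_rmod_def)
  have gf: "g \<circ> f \<in> rmod_mono R N T" by (rule rmod_mono_comp[OF fN gT])
  then have pure: "pure_submodule R T ((g \<circ> f) ` carrier N)"
    using ap T unfolding absolutely_pure_def by blast
  have gh: "g \<in> rmod_hom R K0 T" and hh: "inv_into (carrier K0) g \<in> rmod_hom R T K0"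
    using gT hT by (auto simp: rmod_mono_def)
  have hM: "inv_into (carrier K0) g \<in> rmod_hom R T M"
    using rmod_hom_comp[OF hh inc] by (simp add: o_def)
  have "(\<Oplus>\<^bsub>K0\<^esub>j\<in>{..<n}. a i j \<odot>\<^bsub>K0\<^esub> x j) = b i" if "i < m" for i
    using rmod_hom_linear_combination[OF K0 M inc a _ that, of x] xK sol that by simp
  then have "\<forall>i<m. (\<Oplus>\<^bsub>T\<^esub>j\<in>{..<n}. a i j \<odot>\<^bsub>T\<^esub> g (x j)) = g (b i)"
    using rmod_hom_linear_combination[OF K0 T gh a, of x] xK by simp
  moreover have "\<forall>j<n. g (x j) \<in> carrier T" using xK rmod_homD(1)[OF gh] by simp
  moreover have "\<forall>i<m. g (b i) \<in> (g \<circ> f) ` carrier N" using b by auto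
  ultimately have "\<exists>y. (\<forall>j<n. y j \<in> (g \<circ> f) ` carrier N) \<and>
      (\<forall>i<m. (\<Oplus>\<^bsub>T\<^esub>j\<in>{..<n}. a i j \<odot>\<^bsub>T\<^esub> y j) = g (b i))"
    by (intro pure_submoduleD[OF pure a, of "\<lambda>i. g (b i)" "\<lambda>j. g (x j)"])
  then obtain y where y: "\<forall>j<n. y j \<in> (g \<circ> f) ` carrier N"
    and ys: "\<forall>i<m. (\<Oplus>\<^bsub>T\<^esub>j\<in>{..<n}. a i j \<odot>\<^bsub>T\<^esub> y j) = g (b i)" by blast
  let ?h = "inv_into (carrier K0) g"
  have hg: "?h (g u) = u" if "u \<in> K" for u using inv_into_f_f[OF ginj] that by simp
  have yT: "\<forall>j<n. y j \<in> carrier T" using y rmod_homD(1)[OF gh] fK by auto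
  have "(\<Oplus>\<^bsub>M\<^esub>j\<in>{..<n}. a i j \<odot>\<^bsub>M\<^esub> ?h (y j)) = b i" if "i < m" for i
  proof -
    have "b i \<in> K" using b fK that by auto
    then show ?thesis
      using rmod_hom_linear_combination[OF T M hM a yT that] ys that hg by simp
  qed
  moreover have "\<forall>j<n. ?h (y j) \<in> f ` carrier N"
    using y fK hg[unfolded cK0] by auto
  ultimately show "\<exists>y. (\<forall>j<n. y j \<in> f ` carrier N) \<and>
      (\<forall>i<m. (\<Oplus>\<^bsub>M\<^esub>j\<in>{..<n}. a i j \<odot>\<^bsub>M\<^esub> y j) = b i)"
    by (intro exI[of _ "\<lambda>j. ?h (y j)"]) blast
qed

theorem right_SAP_any_type:
  fixes S :: "('a, 's) module"
  assumes sap: "right_SAP R" and simp: "simple_rmod R S"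
  shows "absolutely_pure R S"
proof -
  have S: "right_module R S" and nz: "carrier S \<noteq> {\<zero>\<^bsub>S\<^esub>}"
    and min: "\<And>H. submodule H R S \<Longrightarrow> H = {\<zero>\<^bsub>S\<^esub>} \<or> H = carrier S"
    using simp by (auto simp: simple_rmod_def)
  interpret S: right_module R S by fact
  obtain c where c: "c \<in> carrier S" "c \<noteq> \<zero>\<^bsub>S\<^esub>" using nz by auto
  define H where "H = (\<lambda>r. r \<odot>\<^bsub>S\<^esub> c) ` carrier R"
  have "submodule H R S"
  proof (rule S.submoduleI')
    show "H \<subseteq> carrier S" using c by (auto simp: H_def)
    show "\<zero>\<^bsub>S\<^esub> \<in> H" unfolding H_def
      by (rule image_eqI[of _ _ "\<zero>\<^bsub>R\<^esub>"]) (use c in \<open>auto simp: S.smult_l_null\<close>)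
  next
    fix x y assume "x \<in> H" "y \<in> H"
    then obtain r s where "r \<in> carrier R" "s \<in> carrier R" "x = r \<odot>\<^bsub>S\<^esub> c" "y = s \<odot>\<^bsub>S\<^esub> c"
      by (auto simp: H_def)
    then show "x \<oplus>\<^bsub>S\<^esub> y \<in> H" unfolding H_def
      by (intro image_eqI[of _ _ "r \<oplus>\<^bsub>R\<^esub> s"]) (use c in \<open>auto simp: S.smult_l_distr\<close>)
  next
    fix s x assume "s \<in> carrier R" "x \<in> H"
    moreover from this obtain r where "r \<in> carrier R" "x = r \<odot>\<^bsub>S\<^esub> c" by (auto simp: H_def)
    ultimately show "s \<odot>\<^bsub>S\<^esub> x \<in> H" unfolding H_def
      by (intro image_eqI[of _ _ "r \<otimes>\<^bsub>R\<^esub> s"]) (use c in \<open>auto simp: S.smult_assoc\<close>)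
  qed
  moreover have "c \<in> H" unfolding H_def
    by (rule image_eqI[of _ _ "\<one>\<^bsub>R\<^esub>"]) (use c in auto)
  ultimately have H: "H = carrier S" using min c by auto
  define g where "g = inv_into (carrier R) (\<lambda>r. r \<odot>\<^bsub>S\<^esub> c)"
  have ginj: "inj_on g (carrier S)"
    unfolding g_def H[symmetric] H_def by (rule inj_on_inv_into) simp
  define T where "T = transport_rmod g S"
  let ?h = "inv_into (carrier S) g"
  have T: "right_module R T" and gT: "g \<in> rmod_mono R S T" and hT: "?h \<in> rmod_mono R T S"
    using transport_rmod[OF S ginj] by (auto simp: T_def)
  have hh: "?h \<in> rmod_hom R T S" and gh: "g \<in> rmod_hom R S T"
    using hT gT by (auto simp: rmod_mono_def)
  have cT: "carrier T = g ` carrier S" by (simp add: T_def transport_rmod_def)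
  have hg: "?h (g u) = u" if "u \<in> carrier S" for u using inv_into_f_f[OF ginj] that by simp
  have gimh: "g ` (?h ` L) = L" if "L \<subseteq> carrier T" for L
  proof -
    have "g (?h l) = l" if "l \<in> carrier T" for l using that by (auto simp: cT hg)
    then show ?thesis using that by (force simp: image_image)
  qed
  have zT: "\<zero>\<^bsub>T\<^esub> = g \<zero>\<^bsub>S\<^esub>" by (simp add: T_def transport_rmod_def)
  have "simple_rmod R T"
    unfolding simple_rmod_def
  proof (intro conjI allI impI T)
    have "g c \<in> carrier T" "g c \<noteq> \<zero>\<^bsub>T\<^esub>"
      using c ginj by (auto simp: cT zT inj_on_def)
    then show "carrier T \<noteq> {\<zero>\<^bsub>T\<^esub>}" by auto
  next
    fix L assume L: "submodule L R T"
    have "?h ` L = {\<zero>\<^bsub>S\<^esub>} \<or> ?h ` L = carrier S"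
      by (rule min[OF submodule_image[OF T S hh L]])
    then show "L = {\<zero>\<^bsub>T\<^esub>} \<or> L = carrier T"
      using gimh[OF submoduleD(1)[OF L]] by (auto simp: cT zT)
  qed
  then have apT: "absolutely_pure R T" using sap by (simp add: right_SAP_def)
  have im: "?h ` carrier T = carrier S" by (force simp: cT hg)
  show ?thesis
    unfolding absolutely_pure_def
  proof (intro conjI allI impI S; elim conjE)
    fix M :: "('a, 's \<times> 'a list) module" and f
    assume M: "right_module R M" and f: "f \<in> rmod_mono R S M"
    have "pure_submodule R M ((f \<circ> ?h) ` carrier T)"
      by (rule absolutely_pure_any_type[OF apT M rmod_mono_comp[OF hT f]])
    then show "pure_submodule R M (f ` carrier S)" by (simp only: image_comp[symmetric] im)
  qed
qed

lemma right_module_regular: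
  assumes "ring R" shows "right_module R (regular_rmod R)"
proof -
  interpret R: ring R by fact
  show ?thesis
    by (intro right_module.intro right_module_axioms.intro abelian_groupI R.ring_axioms)
       (auto simp: regular_rmod_def R.a_ac R.r_distr R.l_distr R.m_assoc
         intro: R.l_neg bexI[of _ "\<ominus>\<^bsub>R\<^esub> x" for x])
qed

text \<open>One direction of Baer's criterion; the other one is the theorem below.\<close>

lemma injective_rmod_right_ideal:
  fixes E :: "('a, 'e) module"
  assumes inj: "injective_rmod R E" and J: "submodule J R (regular_rmod R)"
    and p: "p \<in> rmod_hom R (restrict_rmod (regular_rmod R) J) E"
  shows "\<exists>z\<in>carrier E. \<forall>r\<in>J. p r = r \<odot>\<^bsub>E\<^esub> z"
proof -
  interpret E: right_module R E using inj by (simp add: injective_rmod_def)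
  let ?B = "regular_rmod R" and ?A = "restrict_rmod (regular_rmod R) J"
  let ?c = "\<lambda>r :: 'a. (undefined :: 'e, [r])"
  have B: "right_module R ?B" by (rule right_module_regular[OF E.ring_axioms])
  have A: "right_module R ?A" and inc: "(\<lambda>x. x) \<in> rmod_mono R ?A ?B"
    using restrict_rmod[OF B J] by auto
  have cA: "carrier ?A = J" by (simp add: restrict_rmod_def)
  have cB: "carrier ?B = carrier R" by (simp add: regular_rmod_def)
  have JR: "J \<subseteq> carrier R" using submoduleD(1)[OF J] cB by simp
  have ci: "inj_on ?c Z" for Z by (simp add: inj_on_def)
  note tA = transport_rmod[OF A ci[of "carrier ?A"]] and tB = transport_rmod[OF B ci[of "carrier ?B"]]
  let ?A' = "transport_rmod ?c ?A" and ?B' = "transport_rmod ?c ?B"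
  let ?i = "inv_into (carrier ?A) ?c"
  have "?c \<circ> (\<lambda>x. x) \<circ> ?i \<in> rmod_mono R ?A' ?B'"
    by (rule rmod_mono_comp[OF tA(3) rmod_mono_comp[OF inc tB(2)]])
  moreover have "p \<circ> ?i \<in> rmod_hom R ?A' E"
    by (rule rmod_hom_comp[OF _ p]) (use tA(3) in \<open>simp add: rmod_mono_def\<close>)
  ultimately obtain h where h: "h \<in> rmod_hom R ?B' E"
    and hx: "\<forall>x\<in>carrier ?A'. h ((?c \<circ> (\<lambda>x. x) \<circ> ?i) x) = (p \<circ> ?i) x"
    using inj tA(1) tB(1) unfolding injective_rmod_def by blast
  have hc: "h \<circ> ?c \<in> rmod_hom R ?B E"
    by (rule rmod_hom_comp[OF _ h]) (use tB(2) in \<open>simp add: rmod_mono_def\<close>)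
  define z where "z = h (?c \<one>\<^bsub>R\<^esub>)"
  have "z \<in> carrier E" using rmod_homD(1)[OF hc, of "\<one>\<^bsub>R\<^esub>"] by (simp add: cB z_def)
  moreover have "p r = r \<odot>\<^bsub>E\<^esub> z" if r: "r \<in> J" for r
  proof -
    have rR: "r \<in> carrier R" using r JR by auto
    have "?c r \<in> carrier ?A'" using r by (simp add: transport_rmod_def cA)
    then have "p r = h (?c r)"
      using hx inv_into_f_f[OF ci, of r "carrier ?A"] r cA by force
    also have "r = r \<odot>\<^bsub>?B\<^esub> \<one>\<^bsub>R\<^esub>" using rR by (simp add: regular_rmod_def)
    then have "h (?c r) = (h \<circ> ?c) (r \<odot>\<^bsub>?B\<^esub> \<one>\<^bsub>R\<^esub>)" by simp
    also have "\<dots> = r \<odot>\<^bsub>E\<^esub> z" using rmod_homD(3)[OF hc rR, of "\<one>\<^bsub>R\<^esub>"] by (simp add: cB z_def)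
    finally show ?thesis .
  qed
  ultimately show ?thesis by auto
qed

theorem injective_rmod_any_type:
  fixes E :: "('a, 'e) module" and A :: "('a, 'x) module" and B :: "('a, 'y) module"
  assumes inj: "injective_rmod R E" and A: "right_module R A" and B: "right_module R B"
    and f: "f \<in> rmod_mono R A B" and g: "g \<in> rmod_hom R A E"
  shows "\<exists>h\<in>rmod_hom R B E. \<forall>x\<in>carrier A. h (f x) = g x"
proof -
  have E: "right_module R E" using inj by (simp add: injective_rmod_def)
  interpret A: right_module R A by fact
  interpret B: right_module R B by fact
  interpret E: right_module R E by fact
  have fh: "f \<in> rmod_hom R A B" and finj: "inj_on f (carrier A)"
    using f by (auto simp: rmod_mono_def)
  note fD = rmod_homD[OF fh] and gD = rmod_homD[OF g]
  have f0: "f \<zero>\<^bsub>A\<^esub> = \<zero>\<^bsub>B\<^esub>" by (rule rmod_hom_zero[OF A B fh])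
  have g0: "g \<zero>\<^bsub>A\<^esub> = \<zero>\<^bsub>E\<^esub>" by (rule rmod_hom_zero[OF A E g])
  define G0 where "G0 = (\<lambda>x. (f x, g x)) ` carrier A"
  define good where "good = (\<lambda>G. G \<subseteq> carrier B \<times> carrier E
     \<and> (\<forall>b e b' e'. (b, e) \<in> G \<longrightarrow> (b', e') \<in> G \<longrightarrow> (b \<oplus>\<^bsub>B\<^esub> b', e \<oplus>\<^bsub>E\<^esub> e') \<in> G)
     \<and> (\<forall>r b e. r \<in> carrier R \<longrightarrow> (b, e) \<in> G \<longrightarrow> (r \<odot>\<^bsub>B\<^esub> b, r \<odot>\<^bsub>E\<^esub> e) \<in> G)
     \<and> (\<forall>e. (\<zero>\<^bsub>B\<^esub>, e) \<in> G \<longrightarrow> e = \<zero>\<^bsub>E\<^esub>) \<and> G0 \<subseteq> G)"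
  have "good G0"
    unfolding good_def
  proof (intro conjI allI impI subset_refl)
    show "G0 \<subseteq> carrier B \<times> carrier E" using fD(1) gD(1) by (auto simp: G0_def)
  next
    fix b e b' e' assume "(b, e) \<in> G0" "(b', e') \<in> G0"
    then obtain x y where xy: "x \<in> carrier A" "y \<in> carrier A" "b = f x" "e = g x" "b' = f y" "e' = g y"
      by (auto simp: G0_def)
    then show "(b \<oplus>\<^bsub>B\<^esub> b', e \<oplus>\<^bsub>E\<^esub> e') \<in> G0"
      unfolding G0_def by (intro image_eqI[of _ _ "x \<oplus>\<^bsub>A\<^esub> y"]) (auto simp: fD(2) gD(2))
  next
    fix r b e assume r: "r \<in> carrier R" and "(b, e) \<in> G0"
    then obtain x where "x \<in> carrier A" "b = f x" "e = g x" by (auto simp: G0_def)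
    then show "(r \<odot>\<^bsub>B\<^esub> b, r \<odot>\<^bsub>E\<^esub> e) \<in> G0"
      using r unfolding G0_def
      by (intro image_eqI[of _ _ "r \<odot>\<^bsub>A\<^esub> x"]) (auto simp: fD(3) gD(3))
  next
    fix e assume "(\<zero>\<^bsub>B\<^esub>, e) \<in> G0"
    then obtain x where x: "x \<in> carrier A" "f x = f \<zero>\<^bsub>A\<^esub>" "e = g x" by (auto simp: G0_def f0)
    then have "x = \<zero>\<^bsub>A\<^esub>" using finj by (auto simp: inj_on_def)
    then show "e = \<zero>\<^bsub>E\<^esub>" using x g0 by simp
  qed
  then have "Collect good \<noteq> {}" by auto
  moreover have "\<Union>C \<in> Collect good" if "C \<noteq> {}" "subset.chain (Collect good) C" for C
  proof -
    have gC: "good Z" if "Z \<in> C" for Z using \<open>subset.chain _ C\<close> that by (auto simp: subset.chain_def)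
    have tot: "Z \<subseteq> Y \<or> Y \<subseteq> Z" if "Z \<in> C" "Y \<in> C" for Z Y
      using \<open>subset.chain _ C\<close> that by (auto simp: subset.chain_def)
    obtain Z0 where "Z0 \<in> C" using \<open>C \<noteq> {}\<close> by auto
    have "good (\<Union>C)"
      unfolding good_def
    proof (intro conjI allI impI)
      show "\<Union>C \<subseteq> carrier B \<times> carrier E" using gC unfolding good_def by blast
      show "G0 \<subseteq> \<Union>C" using gC[OF \<open>Z0 \<in> C\<close>] \<open>Z0 \<in> C\<close> unfolding good_def by blast
    next
      fix b e b' e' assume "(b, e) \<in> \<Union>C" "(b', e') \<in> \<Union>C"
      then obtain Z where "Z \<in> C" "(b, e) \<in> Z" "(b', e') \<in> Z" using tot by blast
      then show "(b \<oplus>\<^bsub>B\<^esub> b', e \<oplus>\<^bsub>E\<^esub> e') \<in> \<Union>C" using gC unfolding good_def by blast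
    next
      fix r b e assume "r \<in> carrier R" "(b, e) \<in> \<Union>C"
      then show "(r \<odot>\<^bsub>B\<^esub> b, r \<odot>\<^bsub>E\<^esub> e) \<in> \<Union>C" using gC unfolding good_def by blast
    next
      fix e assume "(\<zero>\<^bsub>B\<^esub>, e) \<in> \<Union>C"
      then show "e = \<zero>\<^bsub>E\<^esub>" using gC unfolding good_def by blast
    qed
    then show ?thesis by simp
  qed
  ultimately obtain G where "good G" and max: "\<And>Z. \<lbrakk>good Z; G \<subseteq> Z\<rbrakk> \<Longrightarrow> Z = G"
    using subset_Zorn_nonempty[of "Collect good"] by (metis mem_Collect_eq)
  have Gc: "b \<in> carrier B" "e \<in> carrier E" if "(b, e) \<in> G" for b e
    using \<open>good G\<close> that by (auto simp: good_def)
  have Ga: "(b \<oplus>\<^bsub>B\<^esub> b', e \<oplus>\<^bsub>E\<^esub> e') \<in> G" if "(b, e) \<in> G" "(b', e') \<in> G" for b e b' e'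
    using \<open>good G\<close> that by (auto simp: good_def)
  have Gm: "(r \<odot>\<^bsub>B\<^esub> b, r \<odot>\<^bsub>E\<^esub> e) \<in> G" if "r \<in> carrier R" "(b, e) \<in> G" for r b e
    using \<open>good G\<close> that by (auto simp: good_def)
  have Gz: "e = \<zero>\<^bsub>E\<^esub>" if "(\<zero>\<^bsub>B\<^esub>, e) \<in> G" for e
    using \<open>good G\<close> that by (auto simp: good_def)
  have G0: "G0 \<subseteq> G" using \<open>good G\<close> by (auto simp: good_def)
  have Gzero: "(\<zero>\<^bsub>B\<^esub>, \<zero>\<^bsub>E\<^esub>) \<in> G"
  proof -
    have "(f \<zero>\<^bsub>A\<^esub>, g \<zero>\<^bsub>A\<^esub>) \<in> G0" by (auto simp: G0_def)
    then show ?thesis using G0 f0 g0 by auto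
  qed
  have Gn: "(\<ominus>\<^bsub>B\<^esub> b, \<ominus>\<^bsub>E\<^esub> e) \<in> G" if "(b, e) \<in> G" for b e
    using Gm[of "\<ominus>\<^bsub>R\<^esub> \<one>\<^bsub>R\<^esub>", OF _ that] Gc[OF that]
    by (simp add: B.smult_minus_one E.smult_minus_one)
  have Gf: "e = e'" if "(b, e) \<in> G" "(b, e') \<in> G" for b e e'
  proof -
    have "e \<oplus>\<^bsub>E\<^esub> \<ominus>\<^bsub>E\<^esub> e' = \<zero>\<^bsub>E\<^esub>"
      using Gz Ga[OF that(1) Gn[OF that(2)]] Gc[OF that(1)] by (simp add: B.M.r_neg)
    then have "e = \<ominus>\<^bsub>E\<^esub> (\<ominus>\<^bsub>E\<^esub> e')"
      using Gc(2)[OF that(1)] Gc(2)[OF that(2)]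
      by (intro E.M.minus_equality[symmetric]) auto
    then show ?thesis using Gc(2)[OF that(2)] by simp
  qed
  have total: "\<exists>e. (b, e) \<in> G" if b: "b \<in> carrier B" for b
  proof -
    define J where "J = {r \<in> carrier R. \<exists>e. (r \<odot>\<^bsub>B\<^esub> b, e) \<in> G}"
    define p where "p r = (THE e. (r \<odot>\<^bsub>B\<^esub> b, e) \<in> G)" for r
    have pG: "(r \<odot>\<^bsub>B\<^esub> b, p r) \<in> G" if "r \<in> J" for r
      unfolding p_def by (rule theI') (use that Gf in \<open>auto simp: J_def\<close>)
    have pe: "p r = e" if "(r \<odot>\<^bsub>B\<^esub> b, e) \<in> G" for r e
      unfolding p_def by (rule the_equality) (use that Gf in auto)
    interpret Reg: right_module R "regular_rmod R"
      by (rule right_module_regular[OF A.ring_axioms])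
    have Jadd: "((r \<oplus>\<^bsub>R\<^esub> s) \<odot>\<^bsub>B\<^esub> b, p r \<oplus>\<^bsub>E\<^esub> p s) \<in> G" if "r \<in> J" "s \<in> J" for r s
      using Ga[OF pG[OF that(1)] pG[OF that(2)]] that b by (simp add: J_def B.smult_l_distr)
    have Jmul: "((r \<otimes>\<^bsub>R\<^esub> s) \<odot>\<^bsub>B\<^esub> b, s \<odot>\<^bsub>E\<^esub> p r) \<in> G" if "r \<in> J" "s \<in> carrier R" for r s
      using Gm[OF that(2) pG[OF that(1)]] that b by (simp add: J_def B.smult_assoc)
    have J: "submodule J R (regular_rmod R)"
    proof (rule Reg.submoduleI')
      show "J \<subseteq> carrier (regular_rmod R)" by (auto simp: J_def regular_rmod_def)
      show "\<zero>\<^bsub>regular_rmod R\<^esub> \<in> J"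
        using Gzero b by (auto simp: J_def regular_rmod_def B.smult_l_null)
    next
      fix x y assume "x \<in> J" "y \<in> J"
      then show "x \<oplus>\<^bsub>regular_rmod R\<^esub> y \<in> J"
        using Jadd by (auto simp: J_def regular_rmod_def)
    next
      fix r x assume "r \<in> carrier R" "x \<in> J"
      then show "r \<odot>\<^bsub>regular_rmod R\<^esub> x \<in> J"
        using Jmul by (auto simp: J_def regular_rmod_def)
    qed
    have p: "p \<in> rmod_hom R (restrict_rmod (regular_rmod R) J) E"
      using Gc(2)[OF pG] pe[OF Jadd] pe[OF Jmul]
      by (intro rmod_homI) (auto simp: restrict_rmod_def regular_rmod_def)
    then obtain z where z: "z \<in> carrier E" and pz: "\<And>r. r \<in> J \<Longrightarrow> p r = r \<odot>\<^bsub>E\<^esub> z"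
      using injective_rmod_right_ideal[OF inj J p] by blast
    define G' where "G' = {(d \<oplus>\<^bsub>B\<^esub> r \<odot>\<^bsub>B\<^esub> b, e \<oplus>\<^bsub>E\<^esub> r \<odot>\<^bsub>E\<^esub> z) | d e r. (d, e) \<in> G \<and> r \<in> carrier R}"
    have G'I: "(d \<oplus>\<^bsub>B\<^esub> r \<odot>\<^bsub>B\<^esub> b, e \<oplus>\<^bsub>E\<^esub> r \<odot>\<^bsub>E\<^esub> z) \<in> G'" if "(d, e) \<in> G" "r \<in> carrier R" for d e r
      using that unfolding G'_def by blast
    have sub: "G \<subseteq> G'"
    proof
      fix q assume q: "q \<in> G"
      obtain d e where de: "q = (d, e)" by (cases q)
      show "q \<in> G'" using G'I[of d e "\<zero>\<^bsub>R\<^esub>"] q de Gc[of d e] b z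
        by (simp add: B.smult_l_null E.smult_l_null)
    qed
    have "good G'"
      unfolding good_def
    proof (intro conjI allI impI)
      show "G' \<subseteq> carrier B \<times> carrier E" using Gc b z by (auto simp: G'_def)
      show "G0 \<subseteq> G'" using G0 sub by blast
    next
      fix u v u' v' assume "(u, v) \<in> G'" "(u', v') \<in> G'"
      then obtain d e r d' e' r' where *: "(d, e) \<in> G" "r \<in> carrier R" "(d', e') \<in> G" "r' \<in> carrier R"
        "u = d \<oplus>\<^bsub>B\<^esub> r \<odot>\<^bsub>B\<^esub> b" "v = e \<oplus>\<^bsub>E\<^esub> r \<odot>\<^bsub>E\<^esub> z" "u' = d' \<oplus>\<^bsub>B\<^esub> r' \<odot>\<^bsub>B\<^esub> b" "v' = e' \<oplus>\<^bsub>E\<^esub> r' \<odot>\<^bsub>E\<^esub> z"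
        unfolding G'_def by blast
      show "(u \<oplus>\<^bsub>B\<^esub> u', v \<oplus>\<^bsub>E\<^esub> v') \<in> G'"
        using G'I[OF Ga[OF *(1) *(3)], of "r \<oplus>\<^bsub>R\<^esub> r'"] *(2,4) Gc[OF *(1)] Gc[OF *(3)] b z
        by (simp add: *(5-8) B.smult_l_distr E.smult_l_distr B.M.a_ac E.M.a_ac)
    next
      fix s u v assume s: "s \<in> carrier R" and "(u, v) \<in> G'"
      then obtain d e r where *: "(d, e) \<in> G" "r \<in> carrier R"
        "u = d \<oplus>\<^bsub>B\<^esub> r \<odot>\<^bsub>B\<^esub> b" "v = e \<oplus>\<^bsub>E\<^esub> r \<odot>\<^bsub>E\<^esub> z"
        unfolding G'_def by blast
      show "(s \<odot>\<^bsub>B\<^esub> u, s \<odot>\<^bsub>E\<^esub> v) \<in> G'"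
        using G'I[OF Gm[OF s *(1)], of "r \<otimes>\<^bsub>R\<^esub> s"] *(2) Gc[OF *(1)] b z s
        by (simp add: *(3-4) B.smult_r_distr E.smult_r_distr B.smult_assoc E.smult_assoc)
    next
      fix v assume "(\<zero>\<^bsub>B\<^esub>, v) \<in> G'"
      then obtain d e r where *: "(d, e) \<in> G" "r \<in> carrier R"
        "\<zero>\<^bsub>B\<^esub> = d \<oplus>\<^bsub>B\<^esub> r \<odot>\<^bsub>B\<^esub> b" "v = e \<oplus>\<^bsub>E\<^esub> r \<odot>\<^bsub>E\<^esub> z"
        unfolding G'_def by blast
      note dc = Gc[OF *(1)]
      have "r \<odot>\<^bsub>B\<^esub> b \<oplus>\<^bsub>B\<^esub> d = \<zero>\<^bsub>B\<^esub>" using *(2) *(3)[symmetric] dc b by (simp add: B.M.a_comm)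
      then have "r \<odot>\<^bsub>B\<^esub> b = \<ominus>\<^bsub>B\<^esub> d"
        using *(2) dc b by (intro B.M.minus_equality[symmetric]) auto
      then have rG: "(r \<odot>\<^bsub>B\<^esub> b, \<ominus>\<^bsub>E\<^esub> e) \<in> G" using Gn[OF *(1)] by simp
      then have "r \<in> J" using *(2) by (auto simp: J_def)
      then have "r \<odot>\<^bsub>E\<^esub> z = \<ominus>\<^bsub>E\<^esub> e" using pz pe[OF rG] by simp
      then show "v = \<zero>\<^bsub>E\<^esub>" using *(4) dc by (simp add: E.M.r_neg)
    qed
    then have "G' = G" using max sub by blast
    moreover have "(b, z) \<in> G'"
      using G'I[OF Gzero, of "\<one>\<^bsub>R\<^esub>"] b z by simp
    ultimately show ?thesis by auto
  qed
  define h where "h b = (THE e. (b, e) \<in> G)" for b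
  have hG: "(b, h b) \<in> G" if "b \<in> carrier B" for b
    unfolding h_def by (rule theI') (use total[OF that] Gf in auto)
  have he: "h b = e" if "(b, e) \<in> G" for b e
    unfolding h_def by (rule the_equality) (use that Gf in auto)
  have "h \<in> rmod_hom R B E"
    using Gc(2)[OF hG] he[OF Ga[OF hG hG]] he[OF Gm[OF _ hG]] by (intro rmod_homI) auto
  moreover have "\<forall>x\<in>carrier A. h (f x) = g x"
    using he G0 by (auto simp: G0_def)
  ultimately show ?thesis by blast
qed

end

theory Submission
  imports Defs
begin

text \<open>
  If \<open>u \<noteq> 0\<close> has an essential right annihilator, self-injectivity makes every \<open>1 - ru\<close> a unit.
  For a maximal submodule \<open>N\<close> of \<open>uR\<close>, absolute purity of \<open>uR/N\<close> gives \<open>u(1 - ru) \<in> N\<close> for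
  some \<open>r\<close>, whence \<open>u \<in> N\<close>, a contradiction; so \<open>R\<close> is right nonsingular.  For any \<open>a\<close>,
  injectivity on a complement of its right annihilator yields \<open>b\<close> such that \<open>a - aba\<close> has an
  essential right annihilator, hence \<open>a = aba\<close>.

  Now let \<open>I\<close> be a maximal set of pairwise inequivalent primitive idempotents.  The annihilator
  of all \<open>ReR\<close> with \<open>e \<in> I\<close> is generated by a central idempotent \<open>z\<close>, and \<open>zR\<close> has no minimal
  right ideal.  Self-injectivity shows that every family of \<open>eRe\<close>-linear endomorphisms of the
  \<open>Re\<close> is left multiplication by a unique element of \<open>(1 - z)R\<close>, so that \<open>(1 - z)R\<close> is the
  product of the rings \<open>End(Re)\<close>.
\<close>

section \<open>Right ideals\<close>

context ring
begin

abbreviation right_ideal :: "'a set \<Rightarrow> bool" where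
  "right_ideal J \<equiv> submodule J R (regular_rmod R)"

lemma right_idealI:
  assumes "J \<subseteq> carrier R" "\<zero> \<in> J"
    and "\<And>x y. \<lbrakk>x \<in> J; y \<in> J\<rbrakk> \<Longrightarrow> x \<oplus> y \<in> J"
    and "\<And>x r. \<lbrakk>x \<in> J; r \<in> carrier R\<rbrakk> \<Longrightarrow> x \<otimes> r \<in> J"
  shows "right_ideal J"
  using right_module.submoduleI'[OF right_module_regular[OF ring_axioms], of J] assms
  by (simp add: regular_rmod_def)

lemma right_idealD:
  assumes "right_ideal J"
  shows "x \<in> J \<Longrightarrow> x \<in> carrier R" "\<zero> \<in> J"
    and "\<lbrakk>x \<in> J; y \<in> J\<rbrakk> \<Longrightarrow> x \<oplus> y \<in> J"
    and "\<lbrakk>x \<in> J; r \<in> carrier R\<rbrakk> \<Longrightarrow> x \<otimes> r \<in> J"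
    and "x \<in> J \<Longrightarrow> \<ominus> x \<in> J"
    and "\<lbrakk>x \<in> J; y \<in> J\<rbrakk> \<Longrightarrow> x \<ominus> y \<in> J"
proof -
  note D = submoduleD[OF assms, unfolded regular_rmod_def, simplified]
  show 1: "x \<in> carrier R" if "x \<in> J" for x using D(1) that by auto
  show "\<zero> \<in> J" by (fact D(2))
  show 3: "x \<oplus> y \<in> J" if "x \<in> J" "y \<in> J" for x y using D(3) that by auto
  show "x \<otimes> r \<in> J" if "x \<in> J" "r \<in> carrier R" for x r using D(4) that by auto
  show 5: "\<ominus> x \<in> J" if "x \<in> J" for x
    using D(4)[of "\<ominus> \<one>" x] that 1[OF that] by (simp add: r_minus)
  show "x \<ominus> y \<in> J" if "x \<in> J" "y \<in> J" for x y
    using 3[OF that(1) 5[OF that(2)]] by (simp add: a_minus_def)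
qed

lemma right_ideal_principal:
  assumes "u \<in> carrier R"
  shows "right_ideal ((\<otimes>) u ` carrier R)"
proof (rule right_idealI)
  show "\<zero> \<in> (\<otimes>) u ` carrier R"
    by (rule image_eqI[of _ _ \<zero>]) (use assms in auto)
next
  fix x y assume "x \<in> (\<otimes>) u ` carrier R" "y \<in> (\<otimes>) u ` carrier R"
  then show "x \<oplus> y \<in> (\<otimes>) u ` carrier R"
    using assms by (auto simp: r_distr[symmetric])
next
  fix x r assume "x \<in> (\<otimes>) u ` carrier R" "r \<in> carrier R"
  then show "x \<otimes> r \<in> (\<otimes>) u ` carrier R"
    using assms by (auto simp: m_assoc)
qed (use assms in auto)

lemma right_ideal_zero: "right_ideal {\<zero>}"
  by (rule right_idealI) auto

lemma right_ideal_sum: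
  assumes I: "right_ideal I" and J: "right_ideal J"
  shows "right_ideal {x \<oplus> y | x y. x \<in> I \<and> y \<in> J}"
proof (rule right_idealI)
  show "\<zero> \<in> {x \<oplus> y | x y. x \<in> I \<and> y \<in> J}"
    using right_idealD(2)[OF I] right_idealD(2)[OF J] by force
next
  fix p q assume "p \<in> {x \<oplus> y | x y. x \<in> I \<and> y \<in> J}" "q \<in> {x \<oplus> y | x y. x \<in> I \<and> y \<in> J}"
  then obtain x y x' y' where *: "p = x \<oplus> y" "q = x' \<oplus> y'" "x \<in> I" "x' \<in> I" "y \<in> J" "y' \<in> J"
    by blast
  then have "p \<oplus> q = (x \<oplus> x') \<oplus> (y \<oplus> y')"
    using right_idealD(1)[OF I] right_idealD(1)[OF J] by (simp add: a_ac)
  then show "p \<oplus> q \<in> {x \<oplus> y | x y. x \<in> I \<and> y \<in> J}"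
    using * right_idealD(3)[OF I] right_idealD(3)[OF J] by blast
next
  fix p r assume "p \<in> {x \<oplus> y | x y. x \<in> I \<and> y \<in> J}" and r: "r \<in> carrier R"
  then obtain x y where *: "p = x \<oplus> y" "x \<in> I" "y \<in> J" by blast
  then have "p \<otimes> r = x \<otimes> r \<oplus> y \<otimes> r"
    using right_idealD(1)[OF I] right_idealD(1)[OF J] r by (simp add: l_distr)
  then show "p \<otimes> r \<in> {x \<oplus> y | x y. x \<in> I \<and> y \<in> J}"
    using * r right_idealD(4)[OF I] right_idealD(4)[OF J] by blast
qed (use right_idealD(1)[OF I] right_idealD(1)[OF J] in auto)

lemma right_ideal_Union:
  assumes "C \<noteq> {}" "\<And>J. J \<in> C \<Longrightarrow> right_ideal J"
    and tot: "\<And>I J. \<lbrakk>I \<in> C; J \<in> C\<rbrakk> \<Longrightarrow> I \<subseteq> J \<or> J \<subseteq> I"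
  shows "right_ideal (\<Union>C)"
proof (rule right_idealI)
  show "\<Union>C \<subseteq> carrier R" using right_idealD(1)[OF assms(2)] by blast
  show "\<zero> \<in> \<Union>C" using right_idealD(2)[OF assms(2)] assms(1) by blast
next
  fix x y assume "x \<in> \<Union>C" "y \<in> \<Union>C"
  then obtain J where "J \<in> C" "x \<in> J" "y \<in> J" using tot by blast
  then show "x \<oplus> y \<in> \<Union>C" using right_idealD(3)[OF assms(2)] by blast
next
  fix x r assume "x \<in> \<Union>C" "r \<in> carrier R"
  then show "x \<otimes> r \<in> \<Union>C" using right_idealD(4)[OF assms(2)] by blast
qed

text \<open>Zorn's lemma among right ideals. In both uses \<open>P\<close> is tested element by
  element, so it passes to unions of arbitrary nonempty families and not only of chains.\<close>

lemma right_ideal_Zorn: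
  assumes "right_ideal J0" "P J0"
    and chain: "\<And>C. \<lbrakk>C \<noteq> {}; \<And>J. J \<in> C \<Longrightarrow> P J\<rbrakk> \<Longrightarrow> P (\<Union>C)"
  obtains J where "right_ideal J" "P J" "\<And>H. \<lbrakk>right_ideal H; P H; J \<subseteq> H\<rbrakk> \<Longrightarrow> H = J"
proof -
  have "Collect (\<lambda>J. right_ideal J \<and> P J) \<noteq> {}" using assms(1,2) by auto
  moreover have "\<Union>C \<in> Collect (\<lambda>J. right_ideal J \<and> P J)"
    if "C \<noteq> {}" "subset.chain (Collect (\<lambda>J. right_ideal J \<and> P J)) C" for C
  proof -
    have "right_ideal J \<and> P J" if "J \<in> C" for J
      using \<open>subset.chain _ C\<close> that by (auto simp: subset.chain_def)
    moreover have "I \<subseteq> J \<or> J \<subseteq> I" if "I \<in> C" "J \<in> C" for I J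
      using \<open>subset.chain _ C\<close> that by (auto simp: subset.chain_def)
    ultimately show ?thesis using right_ideal_Union[OF \<open>C \<noteq> {}\<close>] chain[OF \<open>C \<noteq> {}\<close>] by simp
  qed
  ultimately have "\<exists>J\<in>Collect (\<lambda>J. right_ideal J \<and> P J).
      \<forall>H\<in>Collect (\<lambda>J. right_ideal J \<and> P J). J \<subseteq> H \<longrightarrow> H = J"
    by (rule subset_Zorn_nonempty)
  then show ?thesis using that by blast
qed

text \<open>The easy half of Baer's criterion: extend the map to all of R and let z be the image of
  1. Every later appeal to injectivity goes through this form.\<close>

lemma self_injective_extend:
  assumes inj: "right_self_injective R" and J: "right_ideal J"
    and p: "\<And>x. x \<in> J \<Longrightarrow> p x \<in> carrier R"
      "\<And>x y. \<lbrakk>x \<in> J; y \<in> J\<rbrakk> \<Longrightarrow> p (x \<oplus> y) = p x \<oplus> p y"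
      "\<And>x r. \<lbrakk>x \<in> J; r \<in> carrier R\<rbrakk> \<Longrightarrow> p (x \<otimes> r) = p x \<otimes> r"
  obtains z where "z \<in> carrier R" "\<And>x. x \<in> J \<Longrightarrow> p x = z \<otimes> x"
proof -
  have "p \<in> rmod_hom R (restrict_rmod (regular_rmod R) J) (regular_rmod R)"
    using p by (intro rmod_homI) (auto simp: restrict_rmod_def regular_rmod_def)
  from injective_rmod_right_ideal[OF inj[unfolded right_self_injective_def] J this]
  show ?thesis using that by (auto simp: regular_rmod_def)
qed

end


section \<open>Simple modules and purity\<close>

context ring
begin

lemma diff_add_swap:
  assumes "a \<in> carrier R" "b \<in> carrier R" "c \<in> carrier R" "d \<in> carrier R"
  shows "(a \<oplus> b) \<ominus> (c \<oplus> d) = (a \<ominus> c) \<oplus> (b \<ominus> d)"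
  using assms by (simp add: a_minus_def minus_add a_ac)

lemma diff_mult_distrib:
  assumes "a \<in> carrier R" "b \<in> carrier R" "c \<in> carrier R"
  shows "(a \<ominus> b) \<otimes> c = a \<otimes> c \<ominus> b \<otimes> c" "c \<otimes> (a \<ominus> b) = c \<otimes> a \<ominus> c \<otimes> b"
  using assms by (simp_all add: a_minus_def l_distr r_distr l_minus r_minus)

text \<open>The module \<open>R/N\<close> is carried by a set of representatives of the cosets.\<close>

definition quot_rep :: "'a set \<Rightarrow> 'a \<Rightarrow> 'a" where
  "quot_rep N x = (SOME y. y \<in> carrier R \<and> x \<ominus> y \<in> N)"

definition quot_rmod :: "'a set \<Rightarrow> ('a, 'a) module" where
  "quot_rmod N = \<lparr>carrier = quot_rep N ` carrier R, monoid.mult = undefined, one = undefined,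
     ring.zero = quot_rep N \<zero>, ring.add = (\<lambda>x y. quot_rep N (x \<oplus> y)),
     smult = (\<lambda>r x. quot_rep N (x \<otimes> r))\<rparr>"

lemma quot_rep:
  assumes N: "right_ideal N" and x: "x \<in> carrier R"
  shows "quot_rep N x \<in> carrier R" "x \<ominus> quot_rep N x \<in> N"
proof -
  have "\<exists>y. y \<in> carrier R \<and> x \<ominus> y \<in> N"
    using x right_idealD(2)[OF N] by (intro exI[of _ x]) (simp add: r_neg a_minus_def)
  from someI_ex[OF this] show "quot_rep N x \<in> carrier R" "x \<ominus> quot_rep N x \<in> N"
    by (auto simp: quot_rep_def)
qed

lemma quot_rep_eq_iff:
  assumes N: "right_ideal N" and x: "x \<in> carrier R" and y: "y \<in> carrier R"
  shows "quot_rep N x = quot_rep N y \<longleftrightarrow> x \<ominus> y \<in> N"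
proof
  assume eq: "quot_rep N x = quot_rep N y"
  have "(x \<ominus> quot_rep N x) \<ominus> (y \<ominus> quot_rep N y) \<in> N"
    using right_idealD(6)[OF N] quot_rep[OF N] x y by blast
  also have "(x \<ominus> quot_rep N x) \<ominus> (y \<ominus> quot_rep N y) = x \<ominus> y"
    using quot_rep(1)[OF N x] x y unfolding eq
    by (simp add: a_minus_def minus_add a_ac r_neg r_neg2)
  finally show "x \<ominus> y \<in> N" .
next
  assume d: "x \<ominus> y \<in> N"
  \<comment> \<open>Congruent elements define the same predicate, so \<open>SOME\<close> picks the
    same representative for both.\<close>
  have "x \<ominus> w \<in> N \<longleftrightarrow> y \<ominus> w \<in> N" if w: "w \<in> carrier R" for w
  proof -
    have "x \<ominus> w = (x \<ominus> y) \<oplus> (y \<ominus> w)" "y \<ominus> w = (x \<ominus> w) \<ominus> (x \<ominus> y)"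
      using x y w r_neg1[of y "\<ominus> w"] r_neg2[of x "y \<oplus> \<ominus> w"]
      by (simp_all add: a_minus_def minus_add a_ac)
    then show ?thesis using d right_idealD(3,6)[OF N] by metis
  qed
  then have "(\<lambda>w. w \<in> carrier R \<and> x \<ominus> w \<in> N) = (\<lambda>w. w \<in> carrier R \<and> y \<ominus> w \<in> N)" by blast
  then show "quot_rep N x = quot_rep N y" by (simp add: quot_rep_def)
qed

lemma quot_rep_add:
  assumes N: "right_ideal N" and x: "x \<in> carrier R" and y: "y \<in> carrier R"
  shows "quot_rep N (quot_rep N x \<oplus> quot_rep N y) = quot_rep N (x \<oplus> y)"
proof -
  note q = quot_rep(1)[OF N x] quot_rep(1)[OF N y]
  have "(x \<oplus> y) \<ominus> (quot_rep N x \<oplus> quot_rep N y) \<in> N"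
    using right_idealD(3)[OF N quot_rep(2)[OF N x] quot_rep(2)[OF N y]] q x y
    by (simp add: diff_add_swap)
  then show ?thesis by (intro quot_rep_eq_iff[OF N, THEN iffD2, symmetric] a_closed q x y)
qed

lemma quot_rep_mult:
  assumes N: "right_ideal N" and x: "x \<in> carrier R" and r: "r \<in> carrier R"
  shows "quot_rep N (quot_rep N x \<otimes> r) = quot_rep N (x \<otimes> r)"
proof -
  note q = quot_rep(1)[OF N x]
  have "x \<otimes> r \<ominus> quot_rep N x \<otimes> r \<in> N"
    using right_idealD(4)[OF N quot_rep(2)[OF N x] r] q x r
    by (simp add: diff_mult_distrib)
  then show ?thesis by (intro quot_rep_eq_iff[OF N, THEN iffD2, symmetric] m_closed q x r)
qed

lemma quot_rep_idem:
  assumes N: "right_ideal N" and x: "x \<in> carrier R"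
  shows "quot_rep N (quot_rep N x) = quot_rep N x"
  using quot_rep_mult[OF N x one_closed] quot_rep(1)[OF N x] x by simp

lemma right_module_quot:
  assumes N: "right_ideal N"
  shows "right_module R (quot_rmod N)"
    and "quot_rep N \<in> rmod_hom R (regular_rmod R) (quot_rmod N)"
proof -
  note [simp] = quot_rep(1)[OF N] quot_rep_add[OF N] quot_rep_mult[OF N] quot_rep_idem[OF N]
  \<comment> \<open>Associativity in the quotient needs representatives dropped from one summand at
    a time.\<close>
  have al: "quot_rep N (quot_rep N x \<oplus> y) = quot_rep N (x \<oplus> y)"
    and ar: "quot_rep N (y \<oplus> quot_rep N x) = quot_rep N (y \<oplus> x)"
    if "x \<in> carrier R" "y \<in> carrier R" for x y
    using that quot_rep_add[OF N, of "quot_rep N x" y] quot_rep_add[OF N, of y "quot_rep N x"]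
    by simp_all
  have "abelian_group (quot_rmod N)"
  proof (rule abelian_groupI)
    fix x assume "x \<in> carrier (quot_rmod N)"
    then obtain u where u: "u \<in> carrier R" "x = quot_rep N u" by (auto simp: quot_rmod_def)
    then show "\<exists>y\<in>carrier (quot_rmod N). y \<oplus>\<^bsub>quot_rmod N\<^esub> x = \<zero>\<^bsub>quot_rmod N\<^esub>"
      by (intro bexI[of _ "quot_rep N (\<ominus> u)"]) (auto simp: quot_rmod_def l_neg)
    fix y assume "y \<in> carrier (quot_rmod N)"
    then obtain v where v: "v \<in> carrier R" "y = quot_rep N v" by (auto simp: quot_rmod_def)
    show "x \<oplus>\<^bsub>quot_rmod N\<^esub> y = y \<oplus>\<^bsub>quot_rmod N\<^esub> x"
      using u v by (simp add: quot_rmod_def a_comm)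
  qed (auto simp: quot_rmod_def a_assoc al ar)
  then show "right_module R (quot_rmod N)"
    by (intro right_module.intro right_module_axioms.intro ring_axioms)
       (auto simp: quot_rmod_def l_distr r_distr[symmetric] m_assoc)
  show "quot_rep N \<in> rmod_hom R (regular_rmod R) (quot_rmod N)"
    by (rule rmod_homI) (auto simp: quot_rmod_def regular_rmod_def)
qed

text \<open>The equation \<open>x u = u + N\<close> is solved in \<open>R/N\<close> by the class of \<open>1\<close>; purity provides a
  solution in the simple submodule \<open>uR/N\<close>.\<close>

lemma SAP_maximal_submodule:
  assumes sap: "right_SAP R" and u: "u \<in> carrier R"
    and N: "right_ideal N" "N \<subseteq> (\<otimes>) u ` carrier R" "u \<notin> N"
    and max: "\<And>H. \<lbrakk>right_ideal H; N \<subseteq> H; H \<subseteq> (\<otimes>) u ` carrier R; u \<notin> H\<rbrakk> \<Longrightarrow> H = N"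
  obtains r where "r \<in> carrier R" "u \<ominus> u \<otimes> r \<otimes> u \<in> N"
proof -
  let ?M = "quot_rmod N" and ?q = "quot_rep N" and ?U = "(\<otimes>) u ` carrier R"
  note M = right_module_quot(1)[OF N(1)] and q = right_module_quot(2)[OF N(1)]
  interpret M: right_module R ?M by (rule M)
  note [simp] = quot_rep(1)[OF N(1)]
  have U: "right_ideal ?U" by (rule right_ideal_principal[OF u])
  have uU: "u \<in> ?U" by (rule image_eqI[of _ _ \<one>]) (use u in auto)
  have qU: "submodule (?q ` ?U) R ?M"
    by (rule submodule_image[OF right_module_regular[OF ring_axioms] M q U])
  define S where "S = restrict_rmod ?M (?q ` ?U)"
  have S: "right_module R S" and inc: "(\<lambda>x. x) \<in> rmod_mono R S ?M"
    using restrict_rmod[OF M qU] by (auto simp: S_def)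
  have cS: "carrier S = ?q ` ?U" and zS: "\<zero>\<^bsub>S\<^esub> = ?q \<zero>"
    by (auto simp: S_def restrict_rmod_def quot_rmod_def)
  have q0: "?q x = ?q \<zero> \<longleftrightarrow> x \<in> N" if "x \<in> carrier R" for x
    using quot_rep_eq_iff[OF N(1) that zero_closed] that by (simp add: a_minus_def)
  \<comment> \<open>A right ideal inside uR that contains u is all of uR. Maximality among those
    omitting u therefore makes N a maximal proper submodule of uR.\<close>
  have "simple_rmod R S"
    unfolding simple_rmod_def
  proof (intro conjI allI impI S)
    show "carrier S \<noteq> {\<zero>\<^bsub>S\<^esub>}"
      using q0[OF u] N(3) uU by (force simp: cS zS)
  next
    fix H assume H: "submodule H R S"
    note HD = submoduleD[OF H, unfolded cS zS]
    have HA: "?q (x \<oplus> y) \<in> H" if "?q x \<in> H" "?q y \<in> H" "x \<in> carrier R" "y \<in> carrier R" for x y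
      using HD(3)[OF that(1,2)] that quot_rep_add[OF N(1)]
      by (simp add: S_def restrict_rmod_def quot_rmod_def)
    have HM: "?q (x \<otimes> r) \<in> H" if "?q x \<in> H" "x \<in> carrier R" "r \<in> carrier R" for x r
      using HD(4)[OF that(3,1)] that quot_rep_mult[OF N(1)]
      by (simp add: S_def restrict_rmod_def quot_rmod_def)
    \<comment> \<open>Pulling \<open>H\<close> back along \<open>quot_rep N\<close> gives a right
      ideal between N and uR, to which \<open>max\<close> applies.\<close>
    define L where "L = {x \<in> carrier R. ?q x \<in> H}"
    have L: "right_ideal L"
      using HD(2) HA HM by (intro right_idealI) (auto simp: L_def)
    have NL: "N \<subseteq> L"
    proof
      fix x assume x: "x \<in> N"
      then have xR: "x \<in> carrier R" by (rule right_idealD(1)[OF N(1)])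
      show "x \<in> L" using HD(2) q0[OF xR] x xR by (simp add: L_def)
    qed
    have LU: "L \<subseteq> ?U"
    proof
      fix x assume "x \<in> L"
      then have x: "x \<in> carrier R" "?q x \<in> ?q ` ?U" using HD(1) by (auto simp: L_def)
      then obtain y where y: "y \<in> ?U" "?q x = ?q y" by auto
      have yR: "y \<in> carrier R" using y(1) right_idealD(1)[OF U] by auto
      have "x \<ominus> y \<in> ?U" using quot_rep_eq_iff[OF N(1) x(1) yR] y(2) N(2) by auto
      then have "(x \<ominus> y) \<oplus> y \<in> ?U" using y(1) right_idealD(3)[OF U] by blast
      then show "x \<in> ?U" using x yR by (simp add: a_minus_def a_assoc l_neg)
    qed
    have HL: "H = ?q ` L"
    proof
      show "H \<subseteq> ?q ` L"
      proof
        fix h assume h: "h \<in> H"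
        then obtain y where "y \<in> ?U" "h = ?q y" using HD(1) by blast
        then show "h \<in> ?q ` L" using h right_idealD(1)[OF U] by (auto simp: L_def)
      qed
    qed (auto simp: L_def)
    show "H = {\<zero>\<^bsub>S\<^esub>} \<or> H = carrier S"
    proof (cases "u \<in> L")
      case True
      then have "?U \<subseteq> L" using right_idealD(4)[OF L] by auto
      then show ?thesis using HL LU by (auto simp: cS)
    next
      case False
      then have "L = N" using max L NL LU by blast
      then show ?thesis using HL q0 right_idealD(1,2)[OF N(1)] unfolding zS by force
    qed
  qed
  then have "absolutely_pure R S" using sap by (simp add: right_SAP_def)
  then have pure: "pure_submodule R ?M (?q ` ?U)"
    using absolutely_pure_any_type[OF _ M inc] by (simp add: cS)
  have qc: "?q x \<in> carrier ?M" if "x \<in> carrier R" for x using that by (simp add: quot_rmod_def)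
  have "\<exists>y. (\<forall>j<(1::nat). y j \<in> ?q ` ?U) \<and>
      (\<forall>i<(1::nat). (\<Oplus>\<^bsub>?M\<^esub>j\<in>{..<1::nat}. u \<odot>\<^bsub>?M\<^esub> y j) = ?q u)"
  proof (rule pure_submoduleD[OF pure, of 1 1 "\<lambda>_ _. u" "\<lambda>_. ?q u" "\<lambda>_. ?q \<one>"])
    have "u \<odot>\<^bsub>?M\<^esub> ?q \<one> = ?q u" using u quot_rep_mult[OF N(1) one_closed u] by (simp add: quot_rmod_def)
    then show "\<forall>i<1::nat. (\<Oplus>\<^bsub>?M\<^esub>j\<in>{..<1::nat}. u \<odot>\<^bsub>?M\<^esub> ?q \<one>) = ?q u"
      using u qc[OF u] by (simp add: lessThan_Suc)
  qed (use u uU qc in auto)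
  then obtain y where y: "y (0::nat) \<in> ?q ` ?U"
    "(\<Oplus>\<^bsub>?M\<^esub>j\<in>{..<1::nat}. u \<odot>\<^bsub>?M\<^esub> y j) = ?q u" by blast
  \<comment> \<open>Lying in uR/N, the solution is the class of some ur; the equation then says that
    uru and u are congruent modulo N.\<close>
  then obtain r where r: "r \<in> carrier R" "y 0 = ?q (u \<otimes> r)" by blast
  have "y 0 \<in> carrier ?M" using r u qc by simp
  then have "u \<odot>\<^bsub>?M\<^esub> y 0 = ?q u" using y(2) u by (simp add: lessThan_Suc)
  then have "?q u = ?q (u \<otimes> r \<otimes> u)"
    using r u quot_rep_mult[OF N(1), of "u \<otimes> r" u] by (simp add: quot_rmod_def)
  then have "u \<ominus> u \<otimes> r \<otimes> u \<in> N" using quot_rep_eq_iff[OF N(1) u] r u by simp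
  then show ?thesis using r that by blast
qed

end


section \<open>Regularity\<close>

context ring
begin

section \<open>Right annihilators, essential right ideals and complements\<close>

definition right_ann :: "'a \<Rightarrow> 'a set" where
  "right_ann u = {x \<in> carrier R. u \<otimes> x = \<zero>}"

definition essential :: "'a set \<Rightarrow> bool" where
  "essential J \<longleftrightarrow> (\<forall>H. right_ideal H \<and> H \<inter> J \<subseteq> {\<zero>} \<longrightarrow> H = {\<zero>})"

lemma right_ideal_ann: "u \<in> carrier R \<Longrightarrow> right_ideal (right_ann u)"
  by (rule right_idealI) (auto simp: right_ann_def r_distr m_assoc[symmetric])

text \<open>Zorn gives L maximal with K \<inter> L = 0. If H meets K + L trivially, then L + H still
  meets K trivially, so L + H = L by maximality; thus H lies in K + L and is zero.\<close>

lemma complement_exists: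
  assumes K: "right_ideal K"
  obtains L where "right_ideal L" "K \<inter> L \<subseteq> {\<zero>}" "essential {x \<oplus> y | x y. x \<in> K \<and> y \<in> L}"
proof -
  obtain L where L: "right_ideal L" "K \<inter> L \<subseteq> {\<zero>}"
    and max: "\<And>H. \<lbrakk>right_ideal H; K \<inter> H \<subseteq> {\<zero>}; L \<subseteq> H\<rbrakk> \<Longrightarrow> H = L"
    by (rule right_ideal_Zorn[OF right_ideal_zero, of "\<lambda>L. K \<inter> L \<subseteq> {\<zero>}"]) auto
  note KD = right_idealD[OF K] and LD = right_idealD[OF L(1)]
  let ?S = "{x \<oplus> y | x y. x \<in> K \<and> y \<in> L}"
  have "H = {\<zero>}" if H: "right_ideal H" "H \<inter> ?S \<subseteq> {\<zero>}" for H
  proof -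
    note HD = right_idealD[OF H(1)]
    let ?T = "{x \<oplus> y | x y. x \<in> L \<and> y \<in> H}"
    have "k = \<zero>" if k: "k \<in> K" "k = l \<oplus> h" "l \<in> L" "h \<in> H" for k l h
    proof -
      \<comment> \<open>The element h = k - l lies both in H and in K + L, hence is zero, which
        leaves k = l in K \<inter> L.\<close>
      have "h = k \<oplus> \<ominus> l"
        using k KD(1) LD(1) HD(1) by (simp add: a_comm[of l h] a_assoc r_neg)
      then have "h \<in> ?S" using k LD(5) by blast
      then have "h = \<zero>" using k H(2) by blast
      then have "k = l" using k LD(1) by simp
      then show ?thesis using k L(2) by auto
    qed
    then have "K \<inter> ?T \<subseteq> {\<zero>}" by blast
    moreover have "L \<subseteq> ?T"
    proof
      fix l assume "l \<in> L"
      then show "l \<in> ?T" using HD(2) LD(1) by (intro CollectI exI[of _ l] exI[of _ \<zero>]) auto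
    qed
    ultimately have T: "?T = L" by (intro max right_ideal_sum L H)
    have "H \<subseteq> {\<zero>}"
    proof
      fix h assume h: "h \<in> H"
      have "h \<in> ?T" using h HD(1) LD(2) by (intro CollectI exI[of _ \<zero>] exI[of _ h]) auto
      then have "h \<in> L" by (simp only: T)
      then have "h \<in> ?S" using h HD(1) KD(2) by (intro CollectI exI[of _ \<zero>] exI[of _ h]) auto
      then show "h \<in> {\<zero>}" using h H(2) by blast
    qed
    then show ?thesis using HD(2) by blast
  qed
  then show ?thesis using that L by (auto simp: essential_def)
qed

text \<open>Left multiplication by w is injective on L, so its inverse is a homomorphism from the
  right ideal wL into R, and self-injectivity realizes it as left multiplication by some b.\<close>

lemma self_injective_left_inverse:
  assumes inj: "right_self_injective R" and L: "right_ideal L" and w: "w \<in> carrier R"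
    and ker: "\<And>x. \<lbrakk>x \<in> L; w \<otimes> x = \<zero>\<rbrakk> \<Longrightarrow> x = \<zero>"
  obtains b where "b \<in> carrier R" "\<And>x. x \<in> L \<Longrightarrow> b \<otimes> (w \<otimes> x) = x"
proof -
  note LD = right_idealD[OF L]
  have injL: "inj_on ((\<otimes>) w) L"
  proof (rule inj_onI)
    fix x y assume xy: "x \<in> L" "y \<in> L" "w \<otimes> x = w \<otimes> y"
    then have "w \<otimes> (x \<ominus> y) = \<zero>"
      using w LD(1) by (simp add: diff_mult_distrib)
    then have "x \<ominus> y = \<zero>" using ker LD(6) xy by blast
    then show "x = y" using xy LD(1) by simp
  qed
  note inv = inv_into_f_f[OF injL]
  let ?p = "inv_into L ((\<otimes>) w)"
  have wL: "right_ideal ((\<otimes>) w ` L)"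
  proof (rule right_idealI)
    show "(\<otimes>) w ` L \<subseteq> carrier R" using w LD(1) by auto
    show "\<zero> \<in> (\<otimes>) w ` L" by (rule image_eqI[of _ _ \<zero>]) (use w LD(2) in auto)
  next
    fix x y assume "x \<in> (\<otimes>) w ` L" "y \<in> (\<otimes>) w ` L"
    then show "x \<oplus> y \<in> (\<otimes>) w ` L" using w LD(1,3) by (auto simp: r_distr[symmetric])
  next
    fix x r assume "x \<in> (\<otimes>) w ` L" "r \<in> carrier R"
    then show "x \<otimes> r \<in> (\<otimes>) w ` L" using w LD(1,4) by (auto simp: m_assoc)
  qed
  obtain b where "b \<in> carrier R" "\<And>x. x \<in> (\<otimes>) w ` L \<Longrightarrow> ?p x = b \<otimes> x"
  proof (rule self_injective_extend[OF inj wL, of ?p])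
    show "?p x \<in> carrier R" if "x \<in> (\<otimes>) w ` L" for x
      using that LD(1) inv by auto
    show "?p (x \<oplus> y) = ?p x \<oplus> ?p y" if "x \<in> (\<otimes>) w ` L" "y \<in> (\<otimes>) w ` L" for x y
    proof -
      obtain s t where st: "s \<in> L" "t \<in> L" "x = w \<otimes> s" "y = w \<otimes> t" using \<open>x \<in> _\<close> \<open>y \<in> _\<close> by blast
      have "x \<oplus> y = w \<otimes> (s \<oplus> t)" using st w LD(1) by (simp add: r_distr)
      then show ?thesis using st inv LD(3) by simp
    qed
    show "?p (x \<otimes> r) = ?p x \<otimes> r" if "x \<in> (\<otimes>) w ` L" and r: "r \<in> carrier R" for x r
    proof -
      obtain s where s: "s \<in> L" "x = w \<otimes> s" using \<open>x \<in> _\<close> by blast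
      have "x \<otimes> r = w \<otimes> (s \<otimes> r)" using s r w LD(1) by (simp add: m_assoc)
      then show ?thesis using s inv LD(4) r by simp
    qed
  qed blast
  then show ?thesis using inv that by force
qed

text \<open>If (1 - ru)x = 0 and ux = 0, then x = 0. So the right annihilator of 1 - ru meets an
  essential one trivially and vanishes, and \<open>self_injective_left_inverse\<close> applies with
  L = R.\<close>

lemma left_inverse_of_singular:
  assumes inj: "right_self_injective R" and u: "u \<in> carrier R" "essential (right_ann u)"
    and r: "r \<in> carrier R"
  obtains v where "v \<in> carrier R" "v \<otimes> (\<one> \<ominus> r \<otimes> u) = \<one>"
proof -
  let ?w = "\<one> \<ominus> r \<otimes> u"
  have w: "?w \<in> carrier R" using u r by simp
  have "x = \<zero>" if "x \<in> carrier R" "?w \<otimes> x = \<zero>" "u \<otimes> x = \<zero>" for x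
    using that u r by (simp add: diff_mult_distrib m_assoc)
  then have "right_ann ?w \<inter> right_ann u \<subseteq> {\<zero>}" by (auto simp: right_ann_def)
  then have "right_ann ?w = {\<zero>}" using u(2) right_ideal_ann[OF w] by (auto simp: essential_def)
  then have ker: "x = \<zero>" if "x \<in> carrier R" "?w \<otimes> x = \<zero>" for x
    using that by (auto simp: right_ann_def)
  have "right_ideal (carrier R)" by (rule right_idealI) auto
  then obtain b where b: "b \<in> carrier R" "\<And>x. x \<in> carrier R \<Longrightarrow> b \<otimes> (?w \<otimes> x) = x"
    using self_injective_left_inverse[OF inj _ w ker] by metis
  then show ?thesis using that[OF b(1)] b(2)[OF one_closed] w by simp
qed

lemma SAP_self_injective_nonsingular:
  assumes sap: "right_SAP R" and inj: "right_self_injective R"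
    and u: "u \<in> carrier R" "essential (right_ann u)"
  shows "u = \<zero>"
proof (rule ccontr)
  assume nz: "u \<noteq> \<zero>"
  \<comment> \<open>The zero ideal starts the Zorn argument because u is nonzero.\<close>
  obtain N where N: "right_ideal N" "N \<subseteq> (\<otimes>) u ` carrier R \<and> u \<notin> N"
    and max: "\<And>H. \<lbrakk>right_ideal H; H \<subseteq> (\<otimes>) u ` carrier R \<and> u \<notin> H; N \<subseteq> H\<rbrakk> \<Longrightarrow> H = N"
  proof (rule right_ideal_Zorn[OF right_ideal_zero, of "\<lambda>N. N \<subseteq> (\<otimes>) u ` carrier R \<and> u \<notin> N"])
    show "{\<zero>} \<subseteq> (\<otimes>) u ` carrier R \<and> u \<notin> {\<zero>}"
      using nz right_idealD(2)[OF right_ideal_principal[OF u(1)]] by blast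
  qed blast+
  note ND = right_idealD[OF N(1)]
  obtain r where r: "r \<in> carrier R" "u \<ominus> u \<otimes> r \<otimes> u \<in> N"
    by (rule SAP_maximal_submodule[OF sap u(1) N(1)]) (use N max in auto)
  let ?w = "\<one> \<ominus> r \<otimes> u"
  have w: "?w \<in> carrier R" using u r by simp
  obtain v where v: "v \<in> carrier R" "v \<otimes> ?w = \<one>"
    using left_inverse_of_singular[OF inj u r(1)] by blast
  \<comment> \<open>From v(1 - ru) = 1 follows v = 1 + vru, so v is itself of the form 1 - r'u with
    r' = -vr. Hence v also has a left inverse, and v is a two-sided inverse of 1 - ru.\<close>
  obtain v' where v': "v' \<in> carrier R" "v' \<otimes> (\<one> \<ominus> (\<ominus> (v \<otimes> r)) \<otimes> u) = \<one>"
    using left_inverse_of_singular[OF inj u, of "\<ominus> (v \<otimes> r)"] v r by blast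
  have "v \<ominus> v \<otimes> (r \<otimes> u) = \<one>"
    using v r u by (simp add: diff_mult_distrib)
  then have "v = \<one> \<oplus> v \<otimes> (r \<otimes> u)"
    using v r u by (metis a_minus_def a_assoc a_inv_closed l_neg m_closed r_zero)
  then have "v = \<one> \<ominus> (\<ominus> (v \<otimes> r)) \<otimes> u"
    using v r u by (simp add: a_minus_def l_minus m_assoc)
  then have v'v: "v' \<otimes> v = \<one>" using v' by simp
  have "v' = v' \<otimes> (v \<otimes> ?w)" using v v' by simp
  also have "\<dots> = ?w" using v(1) v'(1) w by (simp add: m_assoc[symmetric] v'v)
  finally have wv: "?w \<otimes> v = \<one>" using v'v by simp
  have "u \<otimes> ?w = u \<ominus> u \<otimes> r \<otimes> u" using u r by (simp add: diff_mult_distrib m_assoc)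
  then have "u \<otimes> ?w \<otimes> v \<in> N" using ND(4) r(2) v(1) by simp
  then have "u \<in> N" using wv u v w by (simp add: m_assoc)
  then show False using N by simp
qed

theorem SAP_self_injective_regular:
  assumes sap: "right_SAP R" and inj: "right_self_injective R"
  shows "von_neumann_regular R"
  unfolding von_neumann_regular_def
proof (intro conjI ballI ring_axioms)
  fix a assume a: "a \<in> carrier R"
  have K: "right_ideal (right_ann a)" by (rule right_ideal_ann[OF a])
  obtain L where L: "right_ideal L" "right_ann a \<inter> L \<subseteq> {\<zero>}"
    and ess: "essential {x \<oplus> y | x y. x \<in> right_ann a \<and> y \<in> L}"
    by (rule complement_exists[OF K])
  note LD = right_idealD[OF L(1)]
  have "x = \<zero>" if "x \<in> L" "a \<otimes> x = \<zero>" for x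
    using that L(2) LD(1) by (auto simp: right_ann_def)
  then obtain b where b: "b \<in> carrier R" "\<And>x. x \<in> L \<Longrightarrow> b \<otimes> (a \<otimes> x) = x"
    using self_injective_left_inverse[OF inj L(1) a] by metis
  define u where "u = a \<ominus> a \<otimes> b \<otimes> a"
  have u: "u \<in> carrier R" using a b by (simp add: u_def)
  \<comment> \<open>Both terms of u kill \<open>right_ann a\<close>, and on L the product ba acts as
    the identity. Thus the right annihilator of u contains an essential sum and is essential
    itself.\<close>
  have "u \<otimes> (x \<oplus> y) = \<zero>" if "x \<in> right_ann a" "y \<in> L" for x y
  proof -
    have x: "x \<in> carrier R" "a \<otimes> x = \<zero>" using that by (auto simp: right_ann_def)
    have y: "y \<in> carrier R" using that LD(1) by simp
    have "u \<otimes> x = \<zero>" using x a b(1) by (simp add: u_def diff_mult_distrib m_assoc)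
    moreover have "u \<otimes> y = \<zero>" using y a b that
      by (simp add: u_def diff_mult_distrib m_assoc)
    ultimately show ?thesis using u x y by (simp add: r_distr)
  qed
  then have "{x \<oplus> y | x y. x \<in> right_ann a \<and> y \<in> L} \<subseteq> right_ann u"
    using LD(1) by (auto simp: right_ann_def)
  then have "essential (right_ann u)"
    using ess unfolding essential_def by blast
  then have "u = \<zero>" by (rule SAP_self_injective_nonsingular[OF sap inj u])
  then have "a \<otimes> b \<otimes> a = a" using a b by (simp add: u_def)
  then show "\<exists>x\<in>carrier R. a \<otimes> x \<otimes> a = a" using b by blast
qed

end

section \<open>Primitive idempotents and the annihilator of the socle\<close>

context ring
begin

text \<open>Every nonzero element of eRe gets a right inverse relative to e, with t allowed anywhere
  in R; \<open>corner_inverse\<close> moves t into eRe and makes it two-sided.\<close>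

definition primitive_idem :: "'a \<Rightarrow> bool" where
  "primitive_idem e \<longleftrightarrow> e \<in> carrier R \<and> e \<otimes> e = e \<and> e \<noteq> \<zero> \<and>
     (\<forall>x\<in>carrier R. e \<otimes> x \<otimes> e \<noteq> \<zero> \<longrightarrow> (\<exists>t\<in>carrier R. e \<otimes> x \<otimes> e \<otimes> t = e))"

text \<open>The group eRf is Hom(fR, eR); for minimal right ideals eR and fR its vanishing means
  that they are not isomorphic.\<close>

definition inequivalent :: "'a set \<Rightarrow> bool" where
  "inequivalent E \<longleftrightarrow> (\<forall>e\<in>E. \<forall>f\<in>E. e \<noteq> f \<longrightarrow> (\<forall>x\<in>carrier R. e \<otimes> x \<otimes> f = \<zero>))"

text \<open>For a subset E of R this is the left annihilator of the two-sided ideal generated by E;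
  a further right factor after e would not change the condition.\<close>

definition generated_ann :: "'a set \<Rightarrow> 'a set" where
  "generated_ann E = {x \<in> carrier R. \<forall>e\<in>E. \<forall>r\<in>carrier R. x \<otimes> r \<otimes> e = \<zero>}"

end

section \<open>Regular right self-injective rings\<close>

locale regular_self_injective_ring = ring R for R (structure) +
  assumes regular: "a \<in> carrier R \<Longrightarrow> \<exists>x\<in>carrier R. a \<otimes> x \<otimes> a = a"
    and self_inj: "right_self_injective R"
begin

text \<open>For w = bxa, regularity gives w = wyw, and this product contains the factor ayb =
  0.\<close>

lemma semiprime_swap:
  assumes "a \<in> carrier R" "b \<in> carrier R" "\<And>x. x \<in> carrier R \<Longrightarrow> a \<otimes> x \<otimes> b = \<zero>"
    and x: "x \<in> carrier R"
  shows "b \<otimes> x \<otimes> a = \<zero>"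
proof -
  have w: "b \<otimes> x \<otimes> a \<in> carrier R" using assms by simp
  obtain y where y: "y \<in> carrier R" "b \<otimes> x \<otimes> a \<otimes> y \<otimes> (b \<otimes> x \<otimes> a) = b \<otimes> x \<otimes> a"
    using regular[OF w] by blast
  have "b \<otimes> x \<otimes> a \<otimes> y \<otimes> (b \<otimes> x \<otimes> a) = b \<otimes> x \<otimes> (a \<otimes> y \<otimes> b) \<otimes> (x \<otimes> a)"
    using assms(1,2) x y(1) by (simp add: m_assoc)
  also have "\<dots> = \<zero>" using assms y(1) by simp
  finally show ?thesis using y by simp
qed

text \<open>If eRg = 0 for all e in a maximal family, then also gRe = 0 by
  \<open>semiprime_swap\<close>, so g may be adjoined. By maximality g is already a member, and e =
  g, x = 1 give g = 0, a contradiction.\<close>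

lemma maximal_inequivalent_family:
  obtains I where "\<And>e. e \<in> I \<Longrightarrow> primitive_idem e" "inequivalent I"
    "\<And>g. primitive_idem g \<Longrightarrow> \<exists>e\<in>I. \<exists>x\<in>carrier R. e \<otimes> x \<otimes> g \<noteq> \<zero>"
proof -
  let ?F = "{E. E \<subseteq> Collect primitive_idem \<and> inequivalent E}"
  have "\<exists>I\<in>?F. \<forall>E\<in>?F. I \<subseteq> E \<longrightarrow> E = I"
  proof (rule subset_Zorn_nonempty)
    show "?F \<noteq> {}" by (auto simp: inequivalent_def intro!: exI[of _ "{}"])
  next
    fix C assume "C \<noteq> {}" and C: "subset.chain ?F C"
    have prim: "E \<subseteq> Collect primitive_idem" and ineq: "inequivalent E" if "E \<in> C" for E
      using C that by (auto simp: subset.chain_def)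
    have tot: "E \<subseteq> F \<or> F \<subseteq> E" if "E \<in> C" "F \<in> C" for E F
      using C that unfolding subset_chain_def by blast
    have "e \<otimes> x \<otimes> f = \<zero>"
      if ef: "E \<in> C" "F \<in> C" "e \<in> E" "f \<in> F" "e \<noteq> f" "x \<in> carrier R" for E F e f x
    proof -
      obtain G where "G \<in> C" "e \<in> G" "f \<in> G" using ef tot by blast
      then show ?thesis using ineq ef unfolding inequivalent_def by blast
    qed
    then have "inequivalent (\<Union>C)" by (auto simp: inequivalent_def)
    then show "\<Union>C \<in> ?F" using prim by blast
  qed
  then obtain I where I: "I \<subseteq> Collect primitive_idem" "inequivalent I"
    and max: "\<And>E. \<lbrakk>E \<subseteq> Collect primitive_idem; inequivalent E; I \<subseteq> E\<rbrakk> \<Longrightarrow> E = I"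
    by auto
  have "\<exists>e\<in>I. \<exists>x\<in>carrier R. e \<otimes> x \<otimes> g \<noteq> \<zero>" if g: "primitive_idem g" for g
  proof (rule ccontr)
    assume "\<not> ?thesis"
    then have eg: "e \<otimes> x \<otimes> g = \<zero>" if "e \<in> I" "x \<in> carrier R" for e x using that by blast
    have gR: "g \<in> carrier R" "g \<otimes> g = g" "g \<noteq> \<zero>" using g by (auto simp: primitive_idem_def)
    have "g \<otimes> x \<otimes> e = \<zero>" if "e \<in> I" "x \<in> carrier R" for e x
    proof (rule semiprime_swap[OF _ gR(1) eg[OF \<open>e \<in> I\<close>] \<open>x \<in> carrier R\<close>])
      show "e \<in> carrier R" using I that by (auto simp: primitive_idem_def)
    qed
    then have "inequivalent (insert g I)" using eg I(2) by (auto simp: inequivalent_def)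
    then have "g \<in> I" using max[of "insert g I"] I(1) g by blast
    then show False using eg[of g \<one>] gR by simp
  qed
  then show ?thesis using I by (intro that[of I]) auto
qed

text \<open>With \<open>A\<close> the annihilator of the ideal generated by \<open>E\<close> and \<open>B\<close> the annihilator of
  \<open>A\<close>, the projection \<open>A \<oplus> B \<rightarrow> A\<close> extends to left multiplication by \<open>z\<close>.\<close>

lemma generated_ann_central_idem:
  assumes E: "E \<subseteq> carrier R"
  obtains z where "z \<in> generated_ann E" "\<And>a. a \<in> generated_ann E \<Longrightarrow> z \<otimes> a = a"
    "\<And>r. r \<in> carrier R \<Longrightarrow> z \<otimes> r = r \<otimes> z"
proof -
  let ?A = "generated_ann E"
  define B where "B = {y \<in> carrier R. \<forall>a\<in>?A. y \<otimes> a = \<zero>}"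
  have Al: "r \<otimes> x \<in> ?A" if "x \<in> ?A" "r \<in> carrier R" for x r
    using that E by (auto simp: generated_ann_def m_assoc subset_iff)
  have Ar: "x \<otimes> s \<in> ?A" if x: "x \<in> ?A" and s: "s \<in> carrier R" for x s
  proof -
    have "x \<otimes> s \<otimes> r \<otimes> e = \<zero>" if "e \<in> E" "r \<in> carrier R" for e r
    proof -
      have "x \<otimes> (s \<otimes> r) \<otimes> e = \<zero>" using x s that by (simp add: generated_ann_def)
      then show ?thesis using x s that by (simp add: generated_ann_def m_assoc)
    qed
    then show ?thesis using x s by (simp add: generated_ann_def)
  qed
  have A: "right_ideal ?A"
    using E Ar by (intro right_idealI) (auto simp: generated_ann_def l_distr subset_iff)
  note AD = right_idealD[OF A]
  have B: "right_ideal B"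
    by (rule right_idealI) (auto simp: B_def AD(1) l_distr m_assoc Al)
  note BD = right_idealD[OF B]
  \<comment> \<open>Regularity gives w = w(yw). Here yw is in A, a left ideal, and w in B kills
    it.\<close>
  have AB: "w = \<zero>" if "w \<in> ?A" "w \<in> B" for w
  proof -
    have wR: "w \<in> carrier R" using that AD(1) by blast
    obtain y where y: "y \<in> carrier R" "w \<otimes> y \<otimes> w = w" using regular[OF wR] by blast
    have "w \<otimes> (y \<otimes> w) = \<zero>" using that Al y by (auto simp: B_def)
    then show ?thesis using y wR by (simp add: m_assoc)
  qed
  let ?S = "{x \<oplus> y | x y. x \<in> ?A \<and> y \<in> B}"
  \<comment> \<open>The sum A + B is direct by \<open>AB\<close>, so the A-component is
    unique.\<close>
  define p where "p y = (THE a. a \<in> ?A \<and> (\<exists>b\<in>B. y = a \<oplus> b))" for y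
  have p: "p (a \<oplus> b) = a" if ab: "a \<in> ?A" "b \<in> B" for a b
    unfolding p_def
  proof (rule the_equality)
    show "a \<in> ?A \<and> (\<exists>b'\<in>B. a \<oplus> b = a \<oplus> b')" using ab by blast
  next
    fix a' assume "a' \<in> ?A \<and> (\<exists>b'\<in>B. a \<oplus> b = a' \<oplus> b')"
    then obtain b' where b': "a' \<in> ?A" "b' \<in> B" "a \<oplus> b = a' \<oplus> b'" by blast
    note c = AD(1)[OF ab(1)] BD(1)[OF ab(2)] AD(1)[OF b'(1)] BD(1)[OF b'(2)]
    have "a' \<ominus> a = (a' \<oplus> b') \<ominus> (a \<oplus> b')" using c by (simp add: diff_add_swap)
    also have "\<dots> = b \<ominus> b'" using c by (simp add: b'(3)[symmetric] diff_add_swap)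
    finally have eq: "a' \<ominus> a = b \<ominus> b'" .
    have "a' \<ominus> a = \<zero>"
    proof (rule AB)
      show "a' \<ominus> a \<in> ?A" using AD(6) ab b' by blast
      show "a' \<ominus> a \<in> B" unfolding eq using BD(6) ab b' by blast
    qed
    then show "a' = a" using c by simp
  qed
  obtain z where z: "z \<in> carrier R" "\<And>x. x \<in> ?S \<Longrightarrow> p x = z \<otimes> x"
  proof (rule self_injective_extend[OF self_inj right_ideal_sum[OF A B], of p])
    show "p x \<in> carrier R" if "x \<in> ?S" for x using that p AD(1) by auto
    show "p (x \<oplus> y) = p x \<oplus> p y" if "x \<in> ?S" "y \<in> ?S" for x y
    proof -
      obtain a b a' b' where *: "x = a \<oplus> b" "y = a' \<oplus> b'" "a \<in> ?A" "b \<in> B" "a' \<in> ?A" "b' \<in> B"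
        using \<open>x \<in> ?S\<close> \<open>y \<in> ?S\<close> by blast
      have "x \<oplus> y = (a \<oplus> a') \<oplus> (b \<oplus> b')" using * AD(1) BD(1) by (simp add: a_ac)
      then show ?thesis using * p AD(3) BD(3) by simp
    qed
    show "p (x \<otimes> r) = p x \<otimes> r" if "x \<in> ?S" "r \<in> carrier R" for x r
    proof -
      obtain a b where *: "x = a \<oplus> b" "a \<in> ?A" "b \<in> B" using \<open>x \<in> ?S\<close> by blast
      have "x \<otimes> r = a \<otimes> r \<oplus> b \<otimes> r" using * AD(1) BD(1) that by (simp add: l_distr)
      then show ?thesis using * p AD(4) BD(4) that by simp
    qed
  qed blast
  have za: "z \<otimes> a = a" if "a \<in> ?A" for a
  proof -
    have "a \<in> ?S" using that BD(2) AD(1) by (intro CollectI exI[of _ a] exI[of _ \<zero>]) auto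
    then show ?thesis using z(2)[of a] p[OF that BD(2)] that AD(1) by simp
  qed
  have zb: "z \<otimes> b = \<zero>" if "b \<in> B" for b
  proof -
    have "b \<in> ?S" using that AD(2) BD(1) by (intro CollectI exI[of _ \<zero>] exI[of _ b]) auto
    then show ?thesis using z(2)[of b] p[OF AD(2) that] that BD(1) by simp
  qed
  have eA: "e \<otimes> a = \<zero>" if "e \<in> E" "a \<in> ?A" for e a
  proof -
    have c: "a \<in> carrier R" "e \<in> carrier R" using that E AD(1) by auto
    have "e \<otimes> \<one> \<otimes> a = \<zero>"
      by (rule semiprime_swap[OF c]) (use that in \<open>auto simp: generated_ann_def\<close>)
    then show ?thesis using c by simp
  qed
  \<comment> \<open>Since e annihilates A, so does each re. Thus Re lies in B and is killed by z,
    which puts z into A.\<close>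
  have "r \<otimes> e \<in> B" if "e \<in> E" "r \<in> carrier R" for e r
    using that E eA AD(1) by (auto simp: B_def m_assoc)
  then have zA: "z \<in> ?A" using z(1) zb E by (auto simp: generated_ann_def m_assoc subset_iff)
  have "z \<otimes> r = r \<otimes> z" if r: "r \<in> carrier R" for r
  proof -
    \<comment> \<open>Both terms lie in the two-sided ideal A. As z is the identity on A, their
      difference kills A and so lies in B as well.\<close>
    let ?w = "z \<otimes> r \<ominus> z \<otimes> r \<otimes> z"
    have "?w \<in> ?A" using AD(4,6) zA r z(1) by blast
    moreover have "?w \<in> B"
      using r z(1) za AD(1) by (auto simp: B_def diff_mult_distrib m_assoc)
    ultimately have "?w = \<zero>" by (rule AB)
    then have "z \<otimes> r = z \<otimes> r \<otimes> z" using r z(1) by simp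
    also have "\<dots> = r \<otimes> z" using za[OF Al[OF zA r]] r z(1) by (simp add: m_assoc)
    finally show ?thesis .
  qed
  then show ?thesis using that zA za by blast
qed

end

section \<open>Corner rings\<close>

definition corner :: "('a, 'c) ring_scheme \<Rightarrow> 'a \<Rightarrow> 'a ring" where
  "corner R e = \<lparr>carrier = {e \<otimes>\<^bsub>R\<^esub> x \<otimes>\<^bsub>R\<^esub> e | x. x \<in> carrier R}, monoid.mult = monoid.mult R,
     one = e, ring.zero = ring.zero R, ring.add = ring.add R\<rparr>"

context ring
begin

lemma corner_simps [simp]:
  "x \<otimes>\<^bsub>corner R e\<^esub> y = x \<otimes> y" "x \<oplus>\<^bsub>corner R e\<^esub> y = x \<oplus> y" "\<one>\<^bsub>corner R e\<^esub> = e" "\<zero>\<^bsub>corner R e\<^esub> = \<zero>"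
  by (simp_all add: corner_def)

lemma carrier_corner:
  assumes "e \<in> carrier R" "e \<otimes> e = e"
  shows "carrier (corner R e) = {x \<in> carrier R. e \<otimes> x = x \<and> x \<otimes> e = x}"
proof -
  have "e \<otimes> (e \<otimes> x) = e \<otimes> x" if "x \<in> carrier R" for x
    using assms that m_assoc[of e e x] by simp
  then show ?thesis using assms by (force simp: corner_def m_assoc)
qed

lemma carrier_corner_central:
  assumes "e \<in> carrier R" "e \<otimes> e = e" "\<And>r. r \<in> carrier R \<Longrightarrow> e \<otimes> r = r \<otimes> e"
  shows "carrier (corner R e) = {x \<in> carrier R. e \<otimes> x = x}"
  unfolding carrier_corner[OF assms(1,2)] by (intro Collect_cong) (metis assms(3))

lemma ring_corner:
  assumes e: "e \<in> carrier R" "e \<otimes> e = e"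
  shows "ring (corner R e)"
proof (rule ringI)
  show "abelian_group (corner R e)"
  proof (rule abelian_groupI)
    fix x assume "x \<in> carrier (corner R e)"
    then show "\<exists>y\<in>carrier (corner R e). y \<oplus>\<^bsub>corner R e\<^esub> x = \<zero>\<^bsub>corner R e\<^esub>"
      using e by (intro bexI[of _ "\<ominus> x"]) (auto simp: carrier_corner l_neg l_minus r_minus)
  qed (use e in \<open>auto simp: carrier_corner a_ac l_distr r_distr\<close>)
  show "monoid (corner R e)"
  proof (rule monoidI)
    fix x y assume "x \<in> carrier (corner R e)" "y \<in> carrier (corner R e)"
    then show "x \<otimes>\<^bsub>corner R e\<^esub> y \<in> carrier (corner R e)"
      using e by (simp add: carrier_corner m_assoc) (simp add: m_assoc[symmetric])
  qed (use e in \<open>auto simp: carrier_corner m_assoc\<close>)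
qed (use e in \<open>auto simp: carrier_corner l_distr r_distr\<close>)

section \<open>Decomposition of a ring along a central idempotent\<close>

lemma central_idem_mult:
  assumes e: "e \<in> carrier R" "e \<otimes> e = e" "\<And>r. r \<in> carrier R \<Longrightarrow> e \<otimes> r = r \<otimes> e"
    and x: "x \<in> carrier R" and y: "y \<in> carrier R"
  shows "e \<otimes> (x \<otimes> y) = (e \<otimes> x) \<otimes> (e \<otimes> y)"
proof -
  have "(e \<otimes> x) \<otimes> (e \<otimes> y) = (e \<otimes> (x \<otimes> e)) \<otimes> y" using e(1) x y by (simp add: m_assoc)
  also have "\<dots> = (e \<otimes> e) \<otimes> x \<otimes> y" using e(1) x y e(3)[OF x, symmetric] by (simp add: m_assoc)
  finally show ?thesis using e(1,2) x y by (simp add: m_assoc)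
qed

lemma central_idem_complement:
  assumes z: "z \<in> carrier R" "z \<otimes> z = z" "\<And>r. r \<in> carrier R \<Longrightarrow> z \<otimes> r = r \<otimes> z"
  shows "\<one> \<ominus> z \<in> carrier R" "(\<one> \<ominus> z) \<otimes> (\<one> \<ominus> z) = \<one> \<ominus> z"
    and "r \<in> carrier R \<Longrightarrow> (\<one> \<ominus> z) \<otimes> r = r \<otimes> (\<one> \<ominus> z)"
proof -
  have "z \<ominus> z = \<zero>" using z(1) by (simp add: a_minus_def r_neg)
  then show "\<one> \<ominus> z \<in> carrier R" "(\<one> \<ominus> z) \<otimes> (\<one> \<ominus> z) = \<one> \<ominus> z"
    using z(1,2) by (simp_all add: diff_mult_distrib) (simp add: a_minus_def r_neg)
  show "(\<one> \<ominus> z) \<otimes> r = r \<otimes> (\<one> \<ominus> z)" if "r \<in> carrier R"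
    using z(1) that by (simp add: diff_mult_distrib z(3)[OF that])
qed

text \<open>The coordinates of x are (1 - z)x and zx; addition inverts this map because z and 1 - z
  are orthogonal with sum 1.\<close>

lemma corner_decomposition:
  assumes z: "z \<in> carrier R" "z \<otimes> z = z" "\<And>r. r \<in> carrier R \<Longrightarrow> z \<otimes> r = r \<otimes> z"
  shows "R \<simeq> RDirProd (corner R (\<one> \<ominus> z)) (corner R z)"
proof -
  let ?c = "\<one> \<ominus> z"
  note c = central_idem_complement[OF z]
  have zz: "z \<ominus> z = \<zero>" using z(1) by (simp add: a_minus_def r_neg)
  have cz: "?c \<otimes> z = \<zero>" "z \<otimes> ?c = \<zero>" using z(1,2) by (simp_all add: diff_mult_distrib zz)
  note cc = carrier_corner_central[OF c] and cz' = carrier_corner_central[OF z]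
  let ?h = "\<lambda>x. (?c \<otimes> x, z \<otimes> x)"
  have "?h \<in> ring_hom R (RDirProd (corner R ?c) (corner R z))"
  proof (rule ring_hom_memI)
    fix x assume x: "x \<in> carrier R"
    have "?c \<otimes> (?c \<otimes> x) = ?c \<otimes> x" "z \<otimes> (z \<otimes> x) = z \<otimes> x"
      using m_assoc[OF c(1) c(1) x] m_assoc[OF z(1) z(1) x] c(2) z(2) by simp_all
    then show "?h x \<in> carrier (RDirProd (corner R ?c) (corner R z))"
      using x c(1) z(1) by (simp add: RDirProd_carrier cc cz')
  next
    fix x y assume x: "x \<in> carrier R" and y: "y \<in> carrier R"
    show "?h (x \<otimes> y) = ?h x \<otimes>\<^bsub>RDirProd (corner R ?c) (corner R z)\<^esub> ?h y"
      using central_idem_mult[OF c x y] central_idem_mult[OF z x y]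
      by (simp add: RDirProd_def DirProd_def monoid.defs)
    show "?h (x \<oplus> y) = ?h x \<oplus>\<^bsub>RDirProd (corner R ?c) (corner R z)\<^esub> ?h y"
      using c(1) z(1) x y by (simp add: RDirProd_def DirProd_def monoid.defs r_distr)
  next
    show "?h \<one> = \<one>\<^bsub>RDirProd (corner R ?c) (corner R z)\<^esub>"
      using c(1) z(1) by (simp add: RDirProd_def DirProd_def monoid.defs)
  qed
  moreover have "bij_betw ?h (carrier R) (carrier (RDirProd (corner R ?c) (corner R z)))"
  proof (rule bij_betw_byWitness[of _ "\<lambda>(x, y). x \<oplus> y"])
    show "\<forall>x\<in>carrier R. (case ?h x of (x, y) \<Rightarrow> x \<oplus> y) = x"
      using z(1) by (auto simp: l_distr[symmetric] a_minus_def a_assoc l_neg)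
    show "\<forall>p\<in>carrier (RDirProd (corner R ?c) (corner R z)). ?h (case p of (x, y) \<Rightarrow> x \<oplus> y) = p"
    proof
      fix p assume "p \<in> carrier (RDirProd (corner R ?c) (corner R z))"
      then obtain x y where p: "p = (x, y)" "x \<in> carrier R" "y \<in> carrier R" "?c \<otimes> x = x" "z \<otimes> y = y"
        by (auto simp: RDirProd_carrier cc cz')
      have "?c \<otimes> y = ?c \<otimes> z \<otimes> y" using p c(1) z(1) by (simp add: m_assoc)
      moreover have "z \<otimes> x = z \<otimes> ?c \<otimes> x" using p c(1) z(1) by (simp add: m_assoc)
      ultimately show "?h (case p of (x, y) \<Rightarrow> x \<oplus> y) = p"
        using p c(1) z(1) cz by (simp add: r_distr)
    qed
    show "?h ` carrier R \<subseteq> carrier (RDirProd (corner R ?c) (corner R z))"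
      using calculation by (auto simp: ring_hom_def)
    show "(\<lambda>(x, y). x \<oplus> y) ` carrier (RDirProd (corner R ?c) (corner R z)) \<subseteq> carrier R"
      by (auto simp: RDirProd_carrier cc cz')
  qed
  ultimately show ?thesis by (auto simp: is_ring_iso_def ring_iso_def)
qed

end


section \<open>The homogeneous components of the socle\<close>

text \<open>The locale fixes the outcome of \<open>maximal_inequivalent_family\<close> and
  \<open>generated_ann_central_idem\<close>, so that the components can be defined in terms of one
  choice of I and z.\<close>

locale socle_decomposition = regular_self_injective_ring R for R (structure) +
  fixes I :: "'a set" and z :: 'a
  assumes I_primitive: "e \<in> I \<Longrightarrow> primitive_idem e"
    and I_inequivalent: "inequivalent I"
    and I_maximal: "primitive_idem g \<Longrightarrow> \<exists>e\<in>I. \<exists>x\<in>carrier R. e \<otimes> x \<otimes> g \<noteq> \<zero>"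
    and z_ann: "z \<in> generated_ann I"
    and z_unit: "a \<in> generated_ann I \<Longrightarrow> z \<otimes> a = a"
    and z_central: "r \<in> carrier R \<Longrightarrow> z \<otimes> r = r \<otimes> z"
begin

lemma I_idem: "e \<in> I \<Longrightarrow> e \<in> carrier R" "e \<in> I \<Longrightarrow> e \<otimes> e = e"
  using I_primitive by (auto simp: primitive_idem_def)

lemma z_closed: "z \<in> carrier R"
  using z_ann by (simp add: generated_ann_def)

lemma z_idem: "z \<otimes> z = z"
  using z_unit z_ann by simp

section \<open>The left ideals \<open>Re\<close> as right vector spaces over
  \<open>eRe\<close>\<close>

definition V :: "'a \<Rightarrow> 'a set" where
  "V e = {x \<in> carrier R. x \<otimes> e = x}"

lemma V_closed: "x \<in> V e \<Longrightarrow> x \<in> carrier R"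
  by (simp add: V_def)

lemma V_add: "\<lbrakk>e \<in> I; x \<in> V e; y \<in> V e\<rbrakk> \<Longrightarrow> x \<oplus> y \<in> V e"
  using I_idem by (simp add: V_def l_distr)

lemma V_mult: "\<lbrakk>e \<in> I; x \<in> V e; r \<in> carrier R\<rbrakk> \<Longrightarrow> r \<otimes> x \<in> V e"
  using I_idem by (simp add: V_def m_assoc)

lemma V_smult: "\<lbrakk>e \<in> I; x \<in> V e; d \<in> carrier (corner R e)\<rbrakk> \<Longrightarrow> x \<otimes> d \<in> V e"
  using I_idem by (simp add: V_def m_assoc carrier_corner)

lemma V_zero: "e \<in> I \<Longrightarrow> \<zero> \<in> V e"
  using I_idem by (simp add: V_def)

lemma e_V: "e \<in> I \<Longrightarrow> e \<in> V e"
  using I_idem by (simp add: V_def)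

lemma z_V:
  assumes "e \<in> I" "x \<in> V e"
  shows "z \<otimes> x = \<zero>"
proof -
  have "z \<otimes> x \<otimes> e = \<zero>" using z_ann assms by (simp add: generated_ann_def V_def)
  then show ?thesis using assms z_closed I_idem by (simp add: V_def m_assoc)
qed

text \<open>Writing x = xe and y = yf exhibits the factor eyf, which inequivalence makes
  zero.\<close>

lemma V_other:
  assumes "e \<in> I" "f \<in> I" "e \<noteq> f" "x \<in> V e" "y \<in> V f"
  shows "x \<otimes> y = \<zero>"
proof -
  have "e \<otimes> y \<otimes> f = \<zero>" using I_inequivalent assms by (auto simp: inequivalent_def V_def)
  then have "e \<otimes> y = \<zero>" using assms I_idem by (simp add: V_def m_assoc)
  moreover have "x \<otimes> y = x \<otimes> (e \<otimes> y)"
    using assms I_idem m_assoc[of x e y] by (simp add: V_def)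
  ultimately show ?thesis using assms by (simp add: V_def)
qed

text \<open>The difference kills every Re, so it lies in \<open>generated_ann I\<close>, where z
  acts as the identity; but z also kills it.\<close>

lemma action_unique:
  assumes "w \<in> carrier R" "w' \<in> carrier R" "z \<otimes> w = \<zero>" "z \<otimes> w' = \<zero>"
    and eq: "\<And>e x. \<lbrakk>e \<in> I; x \<in> V e\<rbrakk> \<Longrightarrow> w \<otimes> x = w' \<otimes> x"
  shows "w = w'"
proof -
  have "(w \<ominus> w') \<otimes> r \<otimes> e = \<zero>" if "e \<in> I" "r \<in> carrier R" for e r
  proof -
    have "w \<otimes> (r \<otimes> e) = w' \<otimes> (r \<otimes> e)" using eq V_mult e_V that by simp
    then show ?thesis using assms that I_idem by (simp add: diff_mult_distrib m_assoc)
  qed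
  then have "w \<ominus> w' \<in> generated_ann I" using assms by (simp add: generated_ann_def)
  then have "w \<ominus> w' = z \<otimes> (w \<ominus> w')" using z_unit by simp
  also have "\<dots> = \<zero>" using assms z_closed by (simp add: diff_mult_distrib)
  finally show ?thesis using assms by simp
qed

text \<open>The map \<open>y \<mapsto> w\<close>, where \<open>w\<close> acts on each \<open>V e\<close> as \<open>x \<mapsto> \<phi> e (y x)\<close>, is right linear on
  its domain \<open>J\<close>, a right ideal containing every \<open>V e\<close>, on which it restricts to \<open>\<phi> e\<close>.\<close>

lemma action_exists:
  assumes cl: "\<And>e x. \<lbrakk>e \<in> I; x \<in> V e\<rbrakk> \<Longrightarrow> \<phi> e x \<in> V e"
    and add: "\<And>e x y. \<lbrakk>e \<in> I; x \<in> V e; y \<in> V e\<rbrakk> \<Longrightarrow> \<phi> e (x \<oplus> y) = \<phi> e x \<oplus> \<phi> e y"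
    and mul: "\<And>e x d. \<lbrakk>e \<in> I; x \<in> V e; d \<in> carrier (corner R e)\<rbrakk> \<Longrightarrow> \<phi> e (x \<otimes> d) = \<phi> e x \<otimes> d"
  obtains w where "w \<in> carrier R" "z \<otimes> w = \<zero>" "\<And>e x. \<lbrakk>e \<in> I; x \<in> V e\<rbrakk> \<Longrightarrow> w \<otimes> x = \<phi> e x"
proof -
  define rel where "rel y w \<longleftrightarrow> w \<in> carrier R \<and> z \<otimes> w = \<zero> \<and> (\<forall>e\<in>I. \<forall>x\<in>V e. w \<otimes> x = \<phi> e (y \<otimes> x))"
    for y w
  define J where "J = {y \<in> carrier R. \<exists>w. rel y w}"
  define g where "g y = (THE w. rel y w)" for y
  have g: "g y = w" if "rel y w" for y w
    unfolding g_def
  proof (rule the_equality)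
    show "rel y w" by (fact that)
  next
    fix w' assume "rel y w'"
    then show "w' = w" using that action_unique[of w' w] by (simp add: rel_def)
  qed
  have radd: "rel (y \<oplus> y') (w \<oplus> w')"
    if "rel y w" "rel y' w'" "y \<in> carrier R" "y' \<in> carrier R" for y w y' w'
  proof -
    have "(w \<oplus> w') \<otimes> x = \<phi> e ((y \<oplus> y') \<otimes> x)" if "e \<in> I" "x \<in> V e" for e x
      using \<open>rel y w\<close> \<open>rel y' w'\<close> \<open>y \<in> carrier R\<close> \<open>y' \<in> carrier R\<close> that V_closed[OF that(2)] add V_mult
      by (simp add: rel_def l_distr)
    then show ?thesis using that z_closed by (simp add: rel_def r_distr)
  qed
  have rmul: "rel (y \<otimes> r) (w \<otimes> r)" if "rel y w" "y \<in> carrier R" "r \<in> carrier R" for y w r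
  proof -
    have "w \<otimes> r \<otimes> x = \<phi> e (y \<otimes> r \<otimes> x)" if "e \<in> I" "x \<in> V e" for e x
      using \<open>rel y w\<close> \<open>y \<in> carrier R\<close> \<open>r \<in> carrier R\<close> that V_closed[OF that(2)] V_mult
      by (simp add: rel_def m_assoc)
    moreover have "z \<otimes> (w \<otimes> r) = \<zero>"
      using that z_closed m_assoc[of z w r] by (simp add: rel_def)
    ultimately show ?thesis using that by (simp add: rel_def)
  qed
  have \<phi>0: "\<phi> e \<zero> = \<zero>" if "e \<in> I" for e
  proof -
    have "\<phi> e (\<zero> \<oplus> \<zero>) = \<phi> e \<zero> \<oplus> \<phi> e \<zero>" by (intro add V_zero that)
    moreover have "\<phi> e \<zero> \<in> carrier R" using cl V_zero V_closed that by blast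
    ultimately show ?thesis by simp
  qed
  have rV: "rel y (\<phi> e y)" if y: "y \<in> V e" "e \<in> I" for y e
  proof -
    \<comment> \<open>For f different from e both sides vanish by \<open>V_other\<close>.\<close>
    have "\<phi> e y \<otimes> x = \<phi> f (y \<otimes> x)" if x: "x \<in> V f" "f \<in> I" for x f
    proof (cases "e = f")
      case False
      then show ?thesis using V_other x y cl \<phi>0 by simp
    next
      case True
      have c: "x \<in> carrier R" "x \<otimes> e = x" "y \<in> carrier R" "y \<otimes> e = y"
        "\<phi> e y \<in> carrier R" "\<phi> e y \<otimes> e = \<phi> e y"
        using x y True cl[of e y] by (auto simp: V_def)
      \<comment> \<open>Here yx = y(ex) with ex = exe in eRe, so the linearity of
        \<open>\<phi> e\<close> over eRe applies.\<close>
      have "e \<otimes> x \<in> carrier (corner R e)"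
        using y c I_idem m_assoc[of e e x] by (simp add: carrier_corner) (simp add: m_assoc)
      then have "\<phi> e (y \<otimes> (e \<otimes> x)) = \<phi> e y \<otimes> (e \<otimes> x)" by (intro mul y)
      then show ?thesis
        using y c True I_idem m_assoc[of y e x] m_assoc[of "\<phi> e y" e x] by simp
    qed
    then show ?thesis using V_closed[OF cl[OF y(2,1)]] z_V[OF y(2) cl[OF y(2,1)]] by (simp add: rel_def)
  qed
  have J: "right_ideal J"
  proof (rule right_idealI)
    have "rel \<zero> \<zero>" using \<phi>0 z_closed by (simp add: rel_def V_closed)
    then show "\<zero> \<in> J" by (auto simp: J_def)
    show "J \<subseteq> carrier R" by (auto simp: J_def)
    show "x \<oplus> y \<in> J" if "x \<in> J" "y \<in> J" for x y
      using that radd[of x _ y] unfolding J_def by blast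
    show "x \<otimes> r \<in> J" if "x \<in> J" "r \<in> carrier R" for x r
      using that rmul[of x _ r] unfolding J_def by blast
  qed
  have Jc: "y \<in> carrier R" "rel y (g y)" if "y \<in> J" for y
    using that g by (auto simp: J_def)
  obtain s where s: "s \<in> carrier R" "\<And>y. y \<in> J \<Longrightarrow> g y = s \<otimes> y"
  proof (rule self_injective_extend[OF self_inj J, of g])
    show "g x \<in> carrier R" if "x \<in> J" for x using Jc[OF that] by (simp add: rel_def)
    show "g (x \<oplus> y) = g x \<oplus> g y" if "x \<in> J" "y \<in> J" for x y
      using g radd Jc that by simp
    show "g (x \<otimes> r) = g x \<otimes> r" if "x \<in> J" "r \<in> carrier R" for x r
      using g rmul Jc that by simp
  qed blast
  have sV: "s \<otimes> x = \<phi> e x" if "e \<in> I" "x \<in> V e" for e x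
  proof -
    have "x \<in> J" using rV[OF that(2,1)] V_closed[OF that(2)] by (auto simp: J_def)
    then show ?thesis using s(2) g[OF rV[OF that(2,1)]] by simp
  qed
  \<comment> \<open>Removing zs makes z kill the element without changing its action, since z
    annihilates each \<open>V e\<close>.\<close>
  let ?w = "s \<ominus> z \<otimes> s"
  have "z \<otimes> ?w = \<zero>"
    using s(1) z_closed z_idem m_assoc[of z z s] by (simp add: diff_mult_distrib)
  moreover have "?w \<otimes> x = \<phi> e x" if "e \<in> I" "x \<in> V e" for e x
    using that s(1) z_closed sV z_V[OF that(1) cl[OF that]] V_closed[OF that(2)] V_closed[OF cl[OF that]]
    by (simp add: diff_mult_distrib m_assoc) (simp add: a_minus_def)
  ultimately show ?thesis using that[of ?w] s(1) z_closed by simp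
qed

section \<open>Central idempotents of the homogeneous components\<close>

definition comp :: "'a \<Rightarrow> 'a" where
  "comp e = (SOME w. w \<in> carrier R \<and> z \<otimes> w = \<zero> \<and>
     (\<forall>f\<in>I. \<forall>x\<in>V f. w \<otimes> x = (if f = e then x else \<zero>)))"

text \<open>Existence is \<open>action_exists\<close> for the family that is the identity on
  \<open>V e\<close> and zero on the other spaces; by \<open>action_unique\<close> the choice in
  \<open>comp\<close> is the only one possible.\<close>

lemma comp:
  assumes "e \<in> I"
  shows "comp e \<in> carrier R" "z \<otimes> comp e = \<zero>" "x \<in> V e \<Longrightarrow> comp e \<otimes> x = x"
    "\<lbrakk>f \<in> I; x \<in> V f; f \<noteq> e\<rbrakk> \<Longrightarrow> comp e \<otimes> x = \<zero>"
proof -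
  obtain w where "w \<in> carrier R" "z \<otimes> w = \<zero>"
    "\<And>f x. \<lbrakk>f \<in> I; x \<in> V f\<rbrakk> \<Longrightarrow> w \<otimes> x = (if f = e then x else \<zero>)"
    by (rule action_exists[of "\<lambda>f x. if f = e then x else \<zero>"])
       (auto simp: V_zero I_idem carrier_corner)
  then have "\<exists>w. w \<in> carrier R \<and> z \<otimes> w = \<zero> \<and>
     (\<forall>f\<in>I. \<forall>x\<in>V f. w \<otimes> x = (if f = e then x else \<zero>))" by blast
  from someI_ex[OF this, folded comp_def] assms
  show "comp e \<in> carrier R" "z \<otimes> comp e = \<zero>" "x \<in> V e \<Longrightarrow> comp e \<otimes> x = x"
    "\<lbrakk>f \<in> I; x \<in> V f; f \<noteq> e\<rbrakk> \<Longrightarrow> comp e \<otimes> x = \<zero>" by auto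
qed

lemma z_mult_zero:
  assumes "w \<in> carrier R" "r \<in> carrier R" "z \<otimes> w = \<zero>"
  shows "z \<otimes> (w \<otimes> r) = \<zero>" "z \<otimes> (r \<otimes> w) = \<zero>"
proof -
  show "z \<otimes> (w \<otimes> r) = \<zero>" using assms z_closed m_assoc[of z w r] by simp
  have "z \<otimes> (r \<otimes> w) = z \<otimes> r \<otimes> w" using assms z_closed by (simp add: m_assoc)
  also have "\<dots> = r \<otimes> (z \<otimes> w)"
    using assms(1,2) z_closed by (simp only: z_central m_assoc)
  finally have "z \<otimes> (r \<otimes> w) = r \<otimes> (z \<otimes> w)" .
  then show "z \<otimes> (r \<otimes> w) = \<zero>" using assms by simp
qed

text \<open>Left multiplication by r preserves each \<open>V f\<close>, on which
  \<open>comp e\<close> is the identity or zero. Both products thus act alike, and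
  \<open>action_unique\<close> identifies them.\<close>

lemma comp_central:
  assumes e: "e \<in> I" and r: "r \<in> carrier R"
  shows "comp e \<otimes> r = r \<otimes> comp e"
proof (rule action_unique)
  fix f x assume f: "f \<in> I" and x: "x \<in> V f"
  have "comp e \<otimes> (r \<otimes> x) = r \<otimes> (comp e \<otimes> x)"
    using comp(3,4)[OF e] f x V_mult[OF f x r] r by (cases "f = e") simp_all
  then show "comp e \<otimes> r \<otimes> x = r \<otimes> comp e \<otimes> x"
    using comp(1)[OF e] r V_closed[OF x] by (simp add: m_assoc)
qed (use comp[OF e] r z_mult_zero in auto)

lemma comp_idem:
  assumes e: "e \<in> I"
  shows "comp e \<otimes> comp e = comp e"
proof (rule action_unique)
  fix f x assume f: "f \<in> I" and x: "x \<in> V f"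
  show "comp e \<otimes> comp e \<otimes> x = comp e \<otimes> x"
    using comp[OF e] f x V_closed[OF x] V_zero[OF f] by (cases "f = e") (simp_all add: m_assoc)
qed (use comp[OF e] z_mult_zero in auto)

lemma carrier_component:
  "e \<in> I \<Longrightarrow> carrier (corner R (comp e)) = {x \<in> carrier R. comp e \<otimes> x = x}"
  by (intro carrier_corner_central comp(1) comp_idem comp_central)

text \<open>Everything follows from y = \<open>comp e\<close> y: the vector yx stays in
  \<open>V f\<close>, where \<open>comp e\<close> is zero.\<close>

lemma component_action:
  assumes e: "e \<in> I" and y: "y \<in> carrier (corner R (comp e))"
  shows "y \<in> carrier R" "z \<otimes> y = \<zero>" "\<lbrakk>f \<in> I; x \<in> V f; f \<noteq> e\<rbrakk> \<Longrightarrow> y \<otimes> x = \<zero>"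
proof -
  have y': "y \<in> carrier R" "comp e \<otimes> y = y" using y e by (auto simp: carrier_component)
  then show "y \<in> carrier R" "z \<otimes> y = \<zero>"
    using z_mult_zero(1)[OF comp(1)[OF e] y'(1) comp(2)[OF e]] by auto
  show "y \<otimes> x = \<zero>" if x: "f \<in> I" "x \<in> V f" "f \<noteq> e"
  proof -
    have "y \<otimes> x = comp e \<otimes> (y \<otimes> x)"
      using y' comp(1)[OF e] V_closed[OF x(2)] m_assoc[of "comp e" y x] by simp
    then show ?thesis using comp(4)[OF e x(1) V_mult[OF x(1,2) y'(1)] x(3)] by simp
  qed
qed

end

section \<open>The structure of the components\<close>

text \<open>The singleton lists only move the scalars and vectors to the type that
  \<open>right_full_linear_ring\<close> prescribes.\<close>

definition list_ring :: "('a, 'c) ring_scheme \<Rightarrow> 'a list ring" where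
  "list_ring S = \<lparr>carrier = (\<lambda>x. [x]) ` carrier S, monoid.mult = (\<lambda>a b. [hd a \<otimes>\<^bsub>S\<^esub> hd b]),
     one = [\<one>\<^bsub>S\<^esub>], ring.zero = [\<zero>\<^bsub>S\<^esub>], ring.add = (\<lambda>a b. [hd a \<oplus>\<^bsub>S\<^esub> hd b])\<rparr>"

lemma ring_list_ring:
  assumes "ring S" shows "ring (list_ring S)"
proof -
  interpret S: ring S by fact
  show ?thesis
  proof (rule ringI)
    show "abelian_group (list_ring S)"
    proof (rule abelian_groupI)
      fix x assume "x \<in> carrier (list_ring S)"
      then show "\<exists>y\<in>carrier (list_ring S). y \<oplus>\<^bsub>list_ring S\<^esub> x = \<zero>\<^bsub>list_ring S\<^esub>"
        by (intro bexI[of _ "[\<ominus>\<^bsub>S\<^esub> hd x]"]) (auto simp: list_ring_def S.l_neg)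
    qed (auto simp: list_ring_def S.a_ac)
    show "monoid (list_ring S)"
      by (rule monoidI) (auto simp: list_ring_def S.m_assoc)
  qed (auto simp: list_ring_def S.l_distr S.r_distr)
qed

context socle_decomposition
begin

definition V_module :: "'a \<Rightarrow> ('a list, 'a list) module" where
  "V_module e = \<lparr>carrier = (\<lambda>x. [x]) ` V e, monoid.mult = undefined, one = undefined,
     ring.zero = [\<zero>], ring.add = (\<lambda>u v. [hd u \<oplus> hd v]), smult = (\<lambda>d v. [hd v \<otimes> hd d])\<rparr>"

text \<open>Replacing the right inverse t by ete keeps it in the corner. Right inverses of all
  nonzero elements are two-sided: from xy = e and ys = e follows x = xys = s.\<close>

lemma corner_inverse:
  assumes e: "e \<in> I" and x: "x \<in> carrier (corner R e)" "x \<noteq> \<zero>"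
  obtains y where "y \<in> carrier (corner R e)" "x \<otimes> y = e" "y \<otimes> x = e"
proof -
  note ce = carrier_corner[OF I_idem[OF e]] and eR = I_idem[OF e]
  have right: "\<exists>y\<in>carrier (corner R e). x \<otimes> y = e" if x: "x \<in> carrier (corner R e)" "x \<noteq> \<zero>" for x
  proof -
    have x': "x \<in> carrier R" "e \<otimes> x = x" "x \<otimes> e = x" using x by (auto simp: ce)
    then have "e \<otimes> x \<otimes> e \<noteq> \<zero>" using x by simp
    then obtain t where t: "t \<in> carrier R" "x \<otimes> t = e"
      using I_primitive[OF e] x' unfolding primitive_idem_def by metis
    have "x \<otimes> (e \<otimes> t \<otimes> e) = x \<otimes> e \<otimes> t \<otimes> e" using t(1) x'(1) eR by (simp add: m_assoc)
    also have "\<dots> = e" using t x' eR by simp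
    finally have "x \<otimes> (e \<otimes> t \<otimes> e) = e" .
    moreover have "e \<otimes> t \<otimes> e \<in> carrier (corner R e)" using t by (auto simp: corner_def)
    ultimately show ?thesis by blast
  qed
  obtain y where y: "y \<in> carrier (corner R e)" "x \<otimes> y = e" using right[OF x] by blast
  have y': "y \<in> carrier R" "e \<otimes> y = y" "y \<otimes> e = y" "x \<in> carrier R" "x \<otimes> e = x"
    using x y by (auto simp: ce)
  have "e \<noteq> \<zero>" using I_primitive[OF e] by (simp add: primitive_idem_def)
  then have "y \<noteq> \<zero>" using y y' by auto
  then obtain s where s: "s \<in> carrier (corner R e)" "y \<otimes> s = e" using right[OF y(1)] by blast
  have s': "s \<in> carrier R" "e \<otimes> s = s" using s by (auto simp: ce)
  have "x = x \<otimes> (y \<otimes> s)" using s y' by simp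
  also have "\<dots> = x \<otimes> y \<otimes> s" using s' y' by (simp add: m_assoc)
  also have "\<dots> = s" using y s' by simp
  finally show ?thesis using that y s by blast
qed

lemma division_ring_corner:
  assumes e: "e \<in> I"
  shows "division_ring (list_ring (corner R e))"
proof -
  let ?D = "list_ring (corner R e)"
  note ce = carrier_corner[OF I_idem[OF e]] and eR = I_idem[OF e]
  have e0: "e \<noteq> \<zero>" using I_primitive[OF e] by (simp add: primitive_idem_def)
  have D: "ring ?D" by (intro ring_list_ring ring_corner eR)
  have "u \<in> Units ?D \<longleftrightarrow> u \<in> carrier ?D - {\<zero>\<^bsub>?D\<^esub>}" for u
  proof
    assume "u \<in> Units ?D"
    then obtain v where "u \<in> carrier ?D" "v \<in> carrier ?D" "u \<otimes>\<^bsub>?D\<^esub> v = \<one>\<^bsub>?D\<^esub>"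
      by (auto simp: Units_def)
    then show "u \<in> carrier ?D - {\<zero>\<^bsub>?D\<^esub>}" using e0 by (auto simp: list_ring_def ce)
  next
    assume "u \<in> carrier ?D - {\<zero>\<^bsub>?D\<^esub>}"
    then obtain x where x: "x \<in> carrier (corner R e)" "u = [x]" "x \<noteq> \<zero>"
      by (auto simp: list_ring_def)
    obtain y where "y \<in> carrier (corner R e)" "x \<otimes> y = e" "y \<otimes> x = e"
      by (rule corner_inverse[OF e x(1,3)])
    then show "u \<in> Units ?D" using x by (auto simp: Units_def list_ring_def)
  qed
  then show ?thesis using D e0 by (auto simp: division_ring_def list_ring_def)
qed

lemma right_module_V:
  assumes e: "e \<in> I"
  shows "right_module (list_ring (corner R e)) (V_module e)"
proof -
  note ce = carrier_corner[OF I_idem[OF e]] and eR = I_idem[OF e]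
  have "abelian_group (V_module e)"
  proof (rule abelian_groupI)
    fix u assume "u \<in> carrier (V_module e)"
    then show "\<exists>v\<in>carrier (V_module e). v \<oplus>\<^bsub>V_module e\<^esub> u = \<zero>\<^bsub>V_module e\<^esub>"
      using eR by (intro bexI[of _ "[\<ominus> hd u]"]) (auto simp: V_module_def V_def l_neg l_minus)
  qed (use V_add[OF e] V_zero[OF e] V_closed in \<open>auto simp: V_module_def a_ac\<close>)
  moreover have "right_module_axioms (list_ring (corner R e)) (V_module e)"
    by (rule right_module_axioms.intro)
       (use eR in \<open>auto simp: V_module_def list_ring_def V_def ce l_distr r_distr m_assoc\<close>)
  ultimately show ?thesis
    by (intro right_module.intro ring_list_ring ring_corner eR)
qed

text \<open>Left multiplication on \<open>V e\<close> is faithful on the component, whose elements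
  already vanish on the other spaces. It is onto because any endomorphism of \<open>V e\<close>,
  extended by zero to those spaces, satisfies the hypotheses of
  \<open>action_exists\<close>.\<close>

theorem component_full_linear:
  assumes e: "e \<in> I"
  shows "right_full_linear_ring (corner R (comp e))"
proof -
  let ?S = "corner R (comp e)" and ?D = "list_ring (corner R e)" and ?V = "V_module e"
  note ce = carrier_corner[OF I_idem[OF e]] and eR = I_idem[OF e]
  have cV: "carrier ?V = (\<lambda>x. [x]) ` V e" by (simp add: V_module_def)
  note act = component_action[OF e]
  \<comment> \<open>The restriction to the carrier makes the map extensional, as
    \<open>rmod_End\<close> requires.\<close>
  let ?h = "\<lambda>x. \<lambda>v\<in>carrier ?V. [x \<otimes> hd v]"
  have hV: "[x \<otimes> hd v] \<in> carrier ?V" if "x \<in> carrier ?S" "v \<in> carrier ?V" for x v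
    using that V_mult[OF e] act(1) by (auto simp: cV)
  have hom: "?h x \<in> carrier (rmod_End ?D ?V)" if x: "x \<in> carrier ?S" for x
  proof -
    have "?h x \<in> rmod_hom ?D ?V ?V"
    proof (rule rmod_homI)
      show "?h x v \<in> carrier ?V" if "v \<in> carrier ?V" for v using hV[OF x that] that by simp
      show "?h x (u \<oplus>\<^bsub>?V\<^esub> v) = ?h x u \<oplus>\<^bsub>?V\<^esub> ?h x v" if "u \<in> carrier ?V" "v \<in> carrier ?V" for u v
        using that act(1)[OF x] V_add[OF e] V_closed by (auto simp: V_module_def r_distr)
      show "?h x (d \<odot>\<^bsub>?V\<^esub> v) = d \<odot>\<^bsub>?V\<^esub> ?h x v" if "d \<in> carrier ?D" "v \<in> carrier ?V" for d v
        using that act(1)[OF x] V_smult[OF e] V_closed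
        by (auto simp: V_module_def list_ring_def m_assoc ce)
    qed
    then show ?thesis by (simp add: rmod_End_def)
  qed
  have "?h \<in> ring_hom ?S (rmod_End ?D ?V)"
  proof (rule ring_hom_memI)
    show "?h x \<in> carrier (rmod_End ?D ?V)" if "x \<in> carrier ?S" for x by (rule hom[OF that])
  next
    fix x y assume x: "x \<in> carrier ?S" and y: "y \<in> carrier ?S"
    show "?h (x \<otimes>\<^bsub>?S\<^esub> y) = ?h x \<otimes>\<^bsub>rmod_End ?D ?V\<^esub> ?h y"
    proof
      fix v show "?h (x \<otimes>\<^bsub>?S\<^esub> y) v = (?h x \<otimes>\<^bsub>rmod_End ?D ?V\<^esub> ?h y) v"
        using hV[OF y, of v] act(1)[OF x] act(1)[OF y] V_closed
        by (auto simp: rmod_End_def compose_def cV m_assoc)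
    qed
    show "?h (x \<oplus>\<^bsub>?S\<^esub> y) = ?h x \<oplus>\<^bsub>rmod_End ?D ?V\<^esub> ?h y"
    proof
      fix v show "?h (x \<oplus>\<^bsub>?S\<^esub> y) v = (?h x \<oplus>\<^bsub>rmod_End ?D ?V\<^esub> ?h y) v"
        using act(1)[OF x] act(1)[OF y] V_closed
        by (auto simp: rmod_End_def V_module_def l_distr)
    qed
  next
    show "?h \<one>\<^bsub>?S\<^esub> = \<one>\<^bsub>rmod_End ?D ?V\<^esub>"
      using comp(3)[OF e] by (auto simp: rmod_End_def cV fun_eq_iff)
  qed
  moreover have "bij_betw ?h (carrier ?S) (carrier (rmod_End ?D ?V))"
  proof (intro bij_betw_imageI inj_onI)
    fix x y assume x: "x \<in> carrier ?S" and y: "y \<in> carrier ?S" and eq: "?h x = ?h y"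
    show "x = y"
    proof (rule action_unique)
      fix f v assume f: "f \<in> I" "v \<in> V f"
      show "x \<otimes> v = y \<otimes> v"
      proof (cases "f = e")
        case True
        then have "[v] \<in> carrier ?V" using f by (simp add: cV)
        then show ?thesis using fun_cong[OF eq, of "[v]"] by simp
      next
        case False then show ?thesis using act(3)[OF x] act(3)[OF y] f by simp
      qed
    qed (use act(1,2) x y in auto)
  next
    show "?h ` carrier ?S = carrier (rmod_End ?D ?V)"
    proof (intro equalityI subsetI)
      fix g assume "g \<in> ?h ` carrier ?S" then show "g \<in> carrier (rmod_End ?D ?V)" using hom by blast
    next
      fix g assume "g \<in> carrier (rmod_End ?D ?V)"
      then have g: "g \<in> rmod_hom ?D ?V ?V" "g \<in> extensional (carrier ?V)"
        by (auto simp: rmod_End_def)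
      note gD = rmod_homD[OF g(1)]
      have gc: "hd (g [v]) \<in> V e" "g [v] = [hd (g [v])]" if "v \<in> V e" for v
        using gD(1)[of "[v]"] that by (auto simp: cV)
      have gadd: "g [v \<oplus> w] = [hd (g [v]) \<oplus> hd (g [w])]" if "v \<in> V e" "w \<in> V e" for v w
        using gD(2)[of "[v]" "[w]"] that by (auto simp: V_module_def)
      have gmul: "g [v \<otimes> d] = [hd (g [v]) \<otimes> d]" if "v \<in> V e" "d \<in> carrier (corner R e)" for v d
        using gD(3)[of "[d]" "[v]"] that by (auto simp: V_module_def list_ring_def)
      obtain w where w: "w \<in> carrier R" "z \<otimes> w = \<zero>"
        "\<And>f v. \<lbrakk>f \<in> I; v \<in> V f\<rbrakk> \<Longrightarrow> w \<otimes> v = (if f = e then hd (g [v]) else \<zero>)"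
        by (rule action_exists[of "\<lambda>f v. if f = e then hd (g [v]) else \<zero>"])
           (auto simp: gc(1) gadd gmul V_zero I_idem carrier_corner)
      \<comment> \<open>The element w maps \<open>V e\<close> into itself and kills the other
        spaces, so multiplying it by \<open>comp e\<close> leaves its action unchanged; this places
        w in the component.\<close>
      have "comp e \<otimes> w = w"
      proof (rule action_unique)
        fix f v assume f: "f \<in> I" "v \<in> V f"
        have "comp e \<otimes> (w \<otimes> v) = w \<otimes> v"
          using w(3)[OF f] comp(3)[OF e gc(1)] comp(1)[OF e] f by (cases "f = e") simp_all
        then show "comp e \<otimes> w \<otimes> v = w \<otimes> v"
          using comp(1)[OF e] w(1) V_closed[OF f(2)] by (simp add: m_assoc)
      qed (use w comp(1,2)[OF e] z_mult_zero in auto)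
      then have wS: "w \<in> carrier ?S" using w(1) by (simp add: carrier_component[OF e])
      have "?h w = g"
      proof
        fix u show "?h w u = g u"
        proof (cases "u \<in> carrier ?V")
          case True
          then obtain v where v: "v \<in> V e" "u = [v]" by (auto simp: cV)
          then show ?thesis using True w(3)[OF e v(1)] gc(2)[OF v(1)] by simp
        next
          case False then show ?thesis using g(2) by (simp add: extensional_def)
        qed
      qed
      then show "g \<in> ?h ` carrier ?S" using wS by blast
    qed
  qed
  ultimately have "?S \<simeq> rmod_End ?D ?V" by (auto simp: is_ring_iso_def ring_iso_def)
  moreover have "ring ?S" by (intro ring_corner comp(1) comp_idem e)
  ultimately show ?thesis
    unfolding right_full_linear_ring_def
    using division_ring_corner[OF e] right_module_V[OF e] by blast
qed

section \<open>The complement of \<open>zR\<close> as a direct product\<close>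

lemma cocenter_idem:
  shows "\<one> \<ominus> z \<in> carrier R" "(\<one> \<ominus> z) \<otimes> (\<one> \<ominus> z) = \<one> \<ominus> z"
    and "r \<in> carrier R \<Longrightarrow> (\<one> \<ominus> z) \<otimes> r = r \<otimes> (\<one> \<ominus> z)"
  by (rule central_idem_complement[OF z_closed z_idem]; (rule z_central)?; assumption)+

lemma carrier_cocorner:
  "carrier (corner R (\<one> \<ominus> z)) = {x \<in> carrier R. z \<otimes> x = \<zero>}"
proof -
  have "(\<one> \<ominus> z) \<otimes> x = x \<longleftrightarrow> z \<otimes> x = \<zero>" if x: "x \<in> carrier R" for x
  proof
    assume "(\<one> \<ominus> z) \<otimes> x = x"
    then have "z \<otimes> x = z \<otimes> ((\<one> \<ominus> z) \<otimes> x)" by simp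
    also have "\<dots> = \<zero>"
      using x z_closed z_idem m_assoc[of z z x] by (simp add: diff_mult_distrib)
    finally show "z \<otimes> x = \<zero>" .
  next
    assume "z \<otimes> x = \<zero>"
    then show "(\<one> \<ominus> z) \<otimes> x = x"
      using x z_closed by (simp add: diff_mult_distrib) (simp add: a_minus_def)
  qed
  then show ?thesis using carrier_corner_central[OF cocenter_idem] by auto
qed

text \<open>The coordinates \<open>comp e\<close> x determine the action of x on every
  \<open>V e\<close>, hence x itself. Any family of coordinates, with no finiteness condition, is
  glued by \<open>action_exists\<close>, so the full product is reached.\<close>

theorem socle_part_product:
  "corner R (\<one> \<ominus> z) \<simeq> ring_product I (\<lambda>e. corner R (comp e))"
proof -
  let ?S = "corner R (\<one> \<ominus> z)" and ?P = "ring_product I (\<lambda>e. corner R (comp e))"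
  let ?h = "\<lambda>x. \<lambda>e\<in>I. comp e \<otimes> x"
  have cP: "carrier ?P = (\<Pi>\<^sub>E e\<in>I. carrier (corner R (comp e)))" by (simp add: ring_product_def)
  note cS = carrier_cocorner
  have hom: "?h x \<in> carrier ?P" if x: "x \<in> carrier R" for x
  proof -
    have "comp e \<otimes> x \<in> carrier (corner R (comp e))" if e: "e \<in> I" for e
      using comp(1)[OF e] comp_idem[OF e] x m_assoc[of "comp e" "comp e" x]
      by (simp add: carrier_component[OF e])
    then show ?thesis by (simp add: cP)
  qed
  have "?h \<in> ring_hom ?S ?P"
  proof (rule ring_hom_memI)
    fix x y assume x: "x \<in> carrier ?S" and y: "y \<in> carrier ?S"
    show "?h x \<in> carrier ?P" using hom x by (simp add: cS)
    have "comp e \<otimes> (x \<otimes> y) = (comp e \<otimes> x) \<otimes> (comp e \<otimes> y)" if e: "e \<in> I" for e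
      by (rule central_idem_mult[OF comp(1)[OF e] comp_idem[OF e] comp_central[OF e]])
         (use x y in \<open>auto simp: cS\<close>)
    then show "?h (x \<otimes>\<^bsub>?S\<^esub> y) = ?h x \<otimes>\<^bsub>?P\<^esub> ?h y"
      by (auto simp: ring_product_def fun_eq_iff)
    show "?h (x \<oplus>\<^bsub>?S\<^esub> y) = ?h x \<oplus>\<^bsub>?P\<^esub> ?h y"
      using x y comp(1) by (auto simp: ring_product_def fun_eq_iff cS r_distr)
  next
    have "comp e \<otimes> (\<one> \<ominus> z) = comp e" if e: "e \<in> I" for e
    proof -
      have "comp e \<otimes> z = \<zero>" using z_central[OF comp(1)[OF e]] comp(2)[OF e] by simp
      then show ?thesis using comp(1)[OF e] z_closed
        by (simp add: diff_mult_distrib) (simp add: a_minus_def)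
    qed
    then show "?h \<one>\<^bsub>?S\<^esub> = \<one>\<^bsub>?P\<^esub>" by (auto simp: ring_product_def fun_eq_iff)
  qed
  moreover have "bij_betw ?h (carrier ?S) (carrier ?P)"
  proof (intro bij_betw_imageI inj_onI)
    fix x y assume x: "x \<in> carrier ?S" and y: "y \<in> carrier ?S" and eq: "?h x = ?h y"
    have act: "u \<otimes> v = comp e \<otimes> u \<otimes> v" if "u \<in> carrier R" "e \<in> I" "v \<in> V e" for u e v
    proof -
      have "u \<otimes> v = u \<otimes> (comp e \<otimes> v)" using comp(3) that by simp
      also have "\<dots> = u \<otimes> comp e \<otimes> v" using that comp(1) V_closed by (simp add: m_assoc)
      finally show ?thesis using comp_central that by simp
    qed
    show "x = y"
    proof (rule action_unique)
      fix e v assume e: "e \<in> I" "v \<in> V e"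
      have "comp e \<otimes> x = comp e \<otimes> y" using fun_cong[OF eq, of e] e by simp
      then show "x \<otimes> v = y \<otimes> v" using act[of x] act[of y] x y e by (simp add: cS)
    qed (use x y in \<open>auto simp: cS\<close>)
  next
    show "?h ` carrier ?S = carrier ?P"
    proof (intro equalityI subsetI)
      fix g assume "g \<in> ?h ` carrier ?S" then show "g \<in> carrier ?P" using hom by (auto simp: cS)
    next
      fix g assume g: "g \<in> carrier ?P"
      then have ge: "g e \<in> carrier (corner R (comp e))" if "e \<in> I" for e using that by (auto simp: cP)
      have gR: "g e \<in> carrier R" if "e \<in> I" for e using component_action(1)[OF that ge[OF that]] .
      obtain w where w: "w \<in> carrier R" "z \<otimes> w = \<zero>"
        "\<And>e v. \<lbrakk>e \<in> I; v \<in> V e\<rbrakk> \<Longrightarrow> w \<otimes> v = g e \<otimes> v"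
        by (rule action_exists[of "\<lambda>e v. g e \<otimes> v"])
           (auto simp: gR V_mult V_closed r_distr m_assoc I_idem carrier_corner)
      have "comp e \<otimes> w = g e" if e: "e \<in> I" for e
      proof (rule action_unique)
        fix f v assume f: "f \<in> I" "v \<in> V f"
        have gV: "g f \<otimes> v \<in> V f" using V_mult f gR by simp
        have "comp e \<otimes> (w \<otimes> v) = g e \<otimes> v"
        proof (cases "f = e")
          case True then show ?thesis using w(3)[OF f] comp(3)[OF e] gV by simp
        next
          case False
          then show ?thesis
            using w(3)[OF f] comp(4)[OF e f(1) gV] component_action(3)[OF e ge[OF e] f] by simp
        qed
        then show "comp e \<otimes> w \<otimes> v = g e \<otimes> v"
          using comp(1)[OF e] w(1) V_closed[OF f(2)] by (simp add: m_assoc)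
      qed (use w comp(1,2)[OF e] z_mult_zero gR[OF e] component_action(2)[OF e ge[OF e]] in auto)
      then have "?h w = g" using g by (auto simp: cP fun_eq_iff PiE_def extensional_def)
      moreover have "w \<in> carrier ?S" using w by (simp add: cS)
      ultimately show "g \<in> ?h ` carrier ?S" by blast
    qed
  qed
  ultimately show ?thesis by (auto simp: is_ring_iso_def ring_iso_def)
qed

text \<open>By regularity a minimal M would contain a nonzero idempotent e, primitive by minimality.
  Maximality of I gives f in I with fRe nonzero, but e = ze and z is central with fz = 0.\<close>

lemma no_minimal_right_ideal: "\<not> minimal_right_ideal (corner R z) M"
proof
  let ?S = "corner R z"
  assume "minimal_right_ideal ?S M"
  then have M: "submodule M ?S (regular_rmod ?S)" and nz: "M \<noteq> {\<zero>}"
    and min: "\<And>H. \<lbrakk>submodule H ?S (regular_rmod ?S); H \<subseteq> M\<rbrakk> \<Longrightarrow> H = {\<zero>} \<or> H = M"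
    by (auto simp: minimal_right_ideal_def)
  have S: "ring ?S" by (rule ring_corner[OF z_closed z_idem])
  interpret S: ring ?S by (rule S)
  note cS = carrier_corner_central[OF z_closed z_idem z_central]
  note MD = S.right_idealD[OF M, simplified]
  have Mc: "x \<in> carrier R" "z \<otimes> x = x" if "x \<in> M" for x using MD(1)[OF that] by (auto simp: cS)
  have zr: "z \<otimes> r \<in> carrier ?S" if "r \<in> carrier R" for r
    using that z_closed z_idem m_assoc[of z z r] by (simp add: cS)
  \<comment> \<open>M is a right ideal of zR only; it absorbs all of R because xr = x(zr) for x in
    M.\<close>
  have Mr: "x \<otimes> r \<in> M" if x: "x \<in> M" and r: "r \<in> carrier R" for x r
  proof -
    have "x \<otimes> r = x \<otimes> (z \<otimes> r)"
      using Mc[OF x] r z_closed z_central[of x] m_assoc[of x z r] by simp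
    then show ?thesis using MD(4)[OF x zr[OF r]] by simp
  qed
  obtain m where m: "m \<in> M" "m \<noteq> \<zero>" using nz MD(2) by blast
  obtain x where x: "x \<in> carrier R" "m \<otimes> x \<otimes> m = m" using regular Mc m by blast
  define e where "e = m \<otimes> x"
  have eM: "e \<in> M" using Mr m x by (simp add: e_def)
  note eR = Mc[OF eM]
  have ee: "e \<otimes> e = e"
    using x Mc[OF m(1)] m_assoc[of "m \<otimes> x" m x] by (simp add: e_def)
  have e0: "e \<noteq> \<zero>" using m x Mc[OF m(1)] by (auto simp: e_def)
  have "primitive_idem e"
    unfolding primitive_idem_def
  proof (intro conjI ballI impI eR ee e0)
    fix r assume r: "r \<in> carrier R" and n: "e \<otimes> r \<otimes> e \<noteq> \<zero>"
    let ?y = "e \<otimes> r \<otimes> e"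
    have y: "?y \<in> M" using Mr eM r eR by simp
    \<comment> \<open>The nonzero right ideal generated by ere inside M is all of M, so e is a right
      multiple of ere.\<close>
    let ?H = "(\<otimes>\<^bsub>?S\<^esub>) ?y ` carrier ?S"
    have H: "submodule ?H ?S (regular_rmod ?S)" by (rule S.right_ideal_principal[OF MD(1)[OF y]])
    have "?H \<subseteq> M" using MD(4)[OF y] by auto
    moreover have "?y \<in> ?H"
      by (rule image_eqI[of _ _ z]) (use Mc[OF y] z_closed z_idem z_central[of ?y] in \<open>auto simp: cS\<close>)
    then have "?H \<noteq> {\<zero>}" using n by blast
    ultimately have "?H = M" using min[OF H] by blast
    then obtain t where t: "t \<in> carrier ?S" "e = ?y \<otimes> t" using eM by auto
    have "t \<in> carrier R" using t(1) by (simp add: cS)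
    then show "\<exists>t\<in>carrier R. ?y \<otimes> t = e" using t(2) by metis
  qed
  then obtain f r where f: "f \<in> I" "r \<in> carrier R" "f \<otimes> r \<otimes> e \<noteq> \<zero>" using I_maximal by blast
  have fR: "f \<in> carrier R" using I_idem f by simp
  have "f \<otimes> r \<otimes> e = f \<otimes> r \<otimes> (z \<otimes> e)" using eR by simp
  also have "\<dots> = f \<otimes> (r \<otimes> z) \<otimes> e" using fR f(2) eR(1) z_closed by (simp add: m_assoc)
  also have "\<dots> = f \<otimes> (z \<otimes> r) \<otimes> e" using z_central f(2) by simp
  also have "\<dots> = f \<otimes> z \<otimes> r \<otimes> e" using fR f(2) eR(1) z_closed by (simp add: m_assoc)
  also have "f \<otimes> z = \<zero>" using z_central[OF fR] z_V[OF f(1) e_V[OF f(1)]] by simp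
  finally show False using f eR by simp
qed

lemma right_socle_annihilator: "right_socle (corner R z) = {\<zero>\<^bsub>corner R z\<^esub>}"
proof -
  interpret S: ring "corner R z" by (rule ring_corner[OF z_closed z_idem])
  show ?thesis
    \<comment> \<open>The union of minimal right ideals is empty, and the empty set generates the
      zero subgroup.\<close>
    using no_minimal_right_ideal S.add.generate_empty by (simp add: right_socle_def)
qed

end

theorem theorem2p5:
  fixes R :: "'a ring"
  assumes "right_SAP R" and "right_self_injective R"
  shows "von_neumann_regular R \<and>
    (\<exists>(R1 :: 'a ring) (R2 :: 'a ring).
       ring R1 \<and> ring R2 \<and> R \<simeq> RDirProd R1 R2 \<and>
       (\<exists>(I :: 'a set) (S :: 'a \<Rightarrow> 'a ring).
          (\<forall>i\<in>I. right_full_linear_ring (S i)) \<and> R1 \<simeq> ring_product I S) \<and>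
       right_socle R2 = {\<zero>\<^bsub>R2\<^esub>})"
proof -
  have R: "ring R" using assms(1) by (simp add: right_SAP_def)
  interpret ring R by (rule R)
  have reg: "von_neumann_regular R" by (rule SAP_self_injective_regular[OF assms])
  interpret regular_self_injective_ring R
    by unfold_locales (use reg assms(2) in \<open>auto simp: von_neumann_regular_def\<close>)
  \<comment> \<open>The family may be empty: then \<open>generated_ann I\<close> is R, z = 1, and
    the first summand is the zero ring.\<close>
  obtain I where I: "\<And>e. e \<in> I \<Longrightarrow> primitive_idem e" "inequivalent I"
    "\<And>g. primitive_idem g \<Longrightarrow> \<exists>e\<in>I. \<exists>x\<in>carrier R. e \<otimes>\<^bsub>R\<^esub> x \<otimes>\<^bsub>R\<^esub> g \<noteq> \<zero>\<^bsub>R\<^esub>"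
    by (rule maximal_inequivalent_family) blast
  have "I \<subseteq> carrier R" using I(1) by (auto simp: primitive_idem_def)
  then obtain z where z: "z \<in> generated_ann I" "\<And>a. a \<in> generated_ann I \<Longrightarrow> z \<otimes>\<^bsub>R\<^esub> a = a"
    "\<And>r. r \<in> carrier R \<Longrightarrow> z \<otimes>\<^bsub>R\<^esub> r = r \<otimes>\<^bsub>R\<^esub> z"
    by (rule generated_ann_central_idem) blast
  interpret socle_decomposition R I z
    by unfold_locales (fact I z)+
  let ?R1 = "corner R (\<one>\<^bsub>R\<^esub> \<ominus>\<^bsub>R\<^esub> z)" and ?R2 = "corner R z"
  show ?thesis
  proof (intro conjI exI ballI)
    show "von_neumann_regular R" by (rule reg)
    show "ring ?R1" by (rule ring_corner[OF cocenter_idem(1,2)])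
    show "ring ?R2" by (rule ring_corner[OF z_closed z_idem])
    show "R \<simeq> RDirProd ?R1 ?R2" by (rule corner_decomposition[OF z_closed z_idem z_central])
    show "right_full_linear_ring (corner R (comp e))" if "e \<in> I" for e
      by (rule component_full_linear[OF that])
    show "?R1 \<simeq> ring_product I (\<lambda>e. corner R (comp e))" by (rule socle_part_product)
    show "right_socle ?R2 = {\<zero>\<^bsub>?R2\<^esub>}" by (rule right_socle_annihilator)
  qed
qed

end
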